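(* Let $H$ be a fixed ordered graph with exactly one edge. For every fixed positive integer $k$, the List $k$-Coloring problem is solvable in polynomial time on $H$-free ordered graphs.
   Context: An ordered graph is a finite simple graph together with a fixed linear order $\prec$ of its vertex set. An ordered graph $H$ is an induced subgraph of an ordered graph $G$ if $H$ can be obtained from $G$ by deleting vertices, i.e., there is an injective map $V(H)\to V(G)$ preserving the linear order, mapping edges to edges and non-edges to non-edges. $G$ is $H$-free if it does not contain $H$ as an induced subgraph. For $k\in\mathbb{N}$, $[k]=\{1,\dots,k\}$. An instance of List $k$-Coloring is a pair $(G,L)$ where $G$ is an (ordered) graph and $L:V(G)\to 2^{[k]}$; the question is whether there is a proper coloring $c$ of $G$ with $c(v)\in L(v)$ for all $v\in V(G)$. *)

theory Defs
  imports "HOL-Computational_Algebra.Polynomial"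
begin

section \<open>Ordered graphs\<close>

record 'a ograph =
  verts :: "'a set"
  edges :: "'a set set"
  ord :: "'a rel"

definition ordered_graph :: "'a ograph \<Rightarrow> bool" where
  "ordered_graph G \<longleftrightarrow>
     finite (verts G) \<and>
     (\<forall>e \<in> edges G. e \<subseteq> verts G \<and> card e = 2) \<and>
     linear_order_on (verts G) (ord G)"

definition induced_subgraph :: "'a ograph \<Rightarrow> 'b ograph \<Rightarrow> bool" where
  "induced_subgraph H G \<longleftrightarrow>
     (\<exists>f. inj_on f (verts H) \<and> f ` verts H \<subseteq> verts G \<and>
          (\<forall>u \<in> verts H. \<forall>v \<in> verts H.
             ((u, v) \<in> ord H \<longrightarrow> (f u, f v) \<in> ord G) \<and>
             ({u, v} \<in> edges H \<longleftrightarrow> {f u, f v} \<in> edges G)))"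

definition ograph_free :: "'a ograph \<Rightarrow> 'b ograph \<Rightarrow> bool" where
  "ograph_free H G \<longleftrightarrow> \<not> induced_subgraph H G"


section \<open>List colouring\<close>

type_synonym 'a list_coloring_instance = "'a ograph \<times> ('a \<Rightarrow> nat set)"

definition list_coloring_instances :: "nat \<Rightarrow> 'a list_coloring_instance set" where
  "list_coloring_instances k =
     {(G, L). ordered_graph G \<and> (\<forall>v \<in> verts G. L v \<subseteq> {1..k})}"

definition list_colorable :: "'a list_coloring_instance \<Rightarrow> bool" where
  "list_colorable = (\<lambda>(G, L).
     \<exists>c :: 'a \<Rightarrow> nat.
       (\<forall>v \<in> verts G. c v \<in> L v) \<and>
       (\<forall>u v. {u, v} \<in> edges G \<longrightarrow> c u \<noteq> c v))"


section \<open>Instances as bit strings\<close>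

definition vertex_list :: "'a ograph \<Rightarrow> 'a list" where
  "vertex_list G =
     (THE vs. distinct vs \<and> set vs = verts G \<and> sorted_wrt (\<lambda>u v. (u, v) \<in> ord G) vs)"

text \<open>
  The number of vertices in unary, terminated by a zero bit; then the adjacency matrix, row by
  row, with rows and columns in the order of the vertices; then for every vertex the
  characteristic vector of its list as a subset of the colours from 1 to k. Vertices are named
  by their position only, so an encoding determines the instance up to isomorphism.
\<close>

definition encode_instance :: "nat \<Rightarrow> 'a list_coloring_instance \<Rightarrow> bool list" where
  "encode_instance k = (\<lambda>(G, L).
     (let vs = vertex_list G in
        replicate (length vs) True @ [False] @
        concat (map (\<lambda>u. map (\<lambda>v. {u, v} \<in> edges G) vs) vs) @
        concat (map (\<lambda>v. map (\<lambda>i. i \<in> L v) [1..<Suc k]) vs)))"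

lemma vertex_list_ex1:
  assumes "ordered_graph G"
  shows "\<exists>!vs. distinct vs \<and> set vs = verts G \<and> sorted_wrt (\<lambda>u v. (u, v) \<in> ord G) vs"
proof -
  have fin: "finite (verts G)" and lin: "linear_order_on (verts G) (ord G)"
    using assms by (auto simp: ordered_graph_def)
  let ?P = "\<lambda>A vs. distinct vs \<and> set vs = A \<and> sorted_wrt (\<lambda>u v. (u, v) \<in> ord G) vs"
  have tr: "trans (ord G)" and an: "antisym (ord G)" and tot: "total_on (verts G) (ord G)"
    using lin by (auto simp: order_on_defs)
  have "\<exists>vs. ?P A vs" if "A \<subseteq> verts G" for A
    using finite_subset[OF that fin] that
  proof (induction A rule: finite_induct)
    case empty
    show ?case by auto
  next
    case (insert x A)
    then obtain vs where vs: "?P A vs" by blast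
    let ?below = "filter (\<lambda>v. (v, x) \<in> ord G) vs"
    let ?above = "filter (\<lambda>v. (v, x) \<notin> ord G) vs"
    have up: "(x, v) \<in> ord G" if "v \<in> set ?above" for v
      using that vs insert.hyps insert.prems tot by (auto simp: total_on_def)
    have "?P (insert x A) (?below @ x # ?above)"
      using vs insert.hyps up tr by (auto simp: sorted_wrt_append sorted_wrt_filter dest: transD)
    then show ?case by blast
  qed
  then obtain vs where vs: "?P (verts G) vs" by blast
  have "xs = ys" if "?P A xs" "?P A ys" for A xs ys
    using that
  proof (induction xs arbitrary: A ys)
    case Nil
    then show ?case by auto
  next
    case (Cons x xs)
    then obtain y ys' where ys: "ys = y # ys'" by (cases ys) auto
    have "x = y"
      using Cons.prems ys an unfolding antisym_def by (metis list.set_intros(1) set_ConsD sorted_wrt.simps(2))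
    moreover have "xs = ys'"
    proof (rule Cons.IH[of "A - {x}"])
      show "?P (A - {x}) xs" using Cons.prems by auto
      show "?P (A - {x}) ys'" using Cons.prems ys \<open>x = y\<close> by auto
    qed
    ultimately show ?case using ys by simp
  qed
  with vs show ?thesis by blast
qed


section \<open>Polynomial time\<close>

text \<open>
  The model of computation is a random access machine with finitely many registers (those that
  occur in the program), a memory, indirect addressing and structured control flow. Each
  instruction and each test has unit cost. The only arithmetic is addition and truncated
  subtraction, so after t steps the numbers have at most t bits more than the largest number
  in the initial state and the program. Hence polynomial time on this machine is polynomial
  time on Turing machines.
\<close>

type_synonym reg = nat

datatype prog =
    Skip
  | Const reg nat
  | Add reg reg reg
  | Sub reg reg reg
  | Load reg reg
  | Store reg reg
  | Seq prog prog
  | IfNZ reg prog prog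
  | WhileNZ reg prog

type_synonym state = "(reg \<Rightarrow> nat) \<times> (nat \<Rightarrow> nat)"

inductive exec :: "prog \<Rightarrow> state \<Rightarrow> nat \<Rightarrow> state \<Rightarrow> bool" where
  Skip: "exec Skip s 1 s"
| Const: "exec (Const x n) (r, m) 1 (r(x := n), m)"
| Add: "exec (Add x y z) (r, m) 1 (r(x := r y + r z), m)"
| Sub: "exec (Sub x y z) (r, m) 1 (r(x := r y - r z), m)"
| Load: "exec (Load x y) (r, m) 1 (r(x := m (r y)), m)"
| Store: "exec (Store x y) (r, m) 1 (r, m(r x := r y))"
| Seq: "exec p s t s' \<Longrightarrow> exec q s' t' s'' \<Longrightarrow> exec (Seq p q) s (t + t') s''"
| IfTrue: "fst s x \<noteq> 0 \<Longrightarrow> exec p s t s' \<Longrightarrow> exec (IfNZ x p q) s (1 + t) s'"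
| IfFalse: "fst s x = 0 \<Longrightarrow> exec q s t s' \<Longrightarrow> exec (IfNZ x p q) s (1 + t) s'"
| WhileTrue: "fst s x \<noteq> 0 \<Longrightarrow> exec p s t s' \<Longrightarrow> exec (WhileNZ x p) s' t' s'' \<Longrightarrow>
    exec (WhileNZ x p) s (1 + t + t') s''"
| WhileFalse: "fst s x = 0 \<Longrightarrow> exec (WhileNZ x p) s 1 s"

inductive_cases exec_SkipE: "exec Skip s t s'"
inductive_cases exec_ConstE: "exec (Const x n) s t s'"
inductive_cases exec_AddE: "exec (Add x y z) s t s'"
inductive_cases exec_SubE: "exec (Sub x y z) s t s'"
inductive_cases exec_LoadE: "exec (Load x y) s t s'"
inductive_cases exec_StoreE: "exec (Store x y) s t s'"
inductive_cases exec_SeqE: "exec (Seq p q) s t s'"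
inductive_cases exec_IfE: "exec (IfNZ x p q) s t s'"
inductive_cases exec_WhileE: "exec (WhileNZ x p) s t s'"

lemma exec_deterministic:
  assumes "exec p s t s'" and "exec p s u s''"
  shows "t = u \<and> s' = s''"
  using assms
proof (induction arbitrary: u s'' rule: exec.induct)
  case (Seq p s t s' q t' s'')
  from Seq.prems show ?case by (rule exec_SeqE) (metis Seq.IH)
next
  case (IfTrue s x p t s' q)
  from IfTrue.prems show ?case by (rule exec_IfE) (use IfTrue.hyps(1) in \<open>auto dest: IfTrue.IH\<close>)
next
  case (IfFalse s x q t s' p)
  from IfFalse.prems show ?case by (rule exec_IfE) (use IfFalse.hyps(1) in \<open>auto dest: IfFalse.IH\<close>)
next
  case (WhileTrue s x p t s' t' s'')
  from WhileTrue.prems show ?case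
    by (rule exec_WhileE) (metis WhileTrue.IH add_Suc plus_1_eq_Suc, use WhileTrue.hyps(1) in simp)
next
  case (WhileFalse s x p)
  from WhileFalse.prems show ?case by (rule exec_WhileE) (use WhileFalse.hyps in auto)
qed (auto elim: exec_SkipE exec_ConstE exec_AddE exec_SubE exec_LoadE exec_StoreE)

text \<open>
  The input word is stored bit by bit from address 0 on and its length is given in register 0;
  everything else is 0. The answer is read from register 0.
\<close>

definition initial_state :: "bool list \<Rightarrow> state" where
  "initial_state w =
     ((\<lambda>x. if x = 0 then length w else 0),
      (\<lambda>a. if a < length w then of_bool (w ! a) else 0))"

definition computes_within :: "prog \<Rightarrow> bool list \<Rightarrow> nat \<Rightarrow> bool \<Rightarrow> bool" where
  "computes_within p w T b \<longleftrightarrow>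
     (\<exists>t s. exec p (initial_state w) t s \<and> t \<le> T \<and> fst s 0 = of_bool b)"

text \<open>
  A decision problem is given by a set of admissible inputs, their encoding as bit strings and
  the question. As usual for a problem restricted to a class, nothing is required
  of the program on words that do not encode an admissible input.
\<close>

definition polytime_solvable :: "'i set \<Rightarrow> ('i \<Rightarrow> bool list) \<Rightarrow> ('i \<Rightarrow> bool) \<Rightarrow> bool" where
  "polytime_solvable I enc Q \<longleftrightarrow>
     (\<exists>(p :: prog) (b :: nat poly).
        \<forall>x \<in> I. computes_within p (enc x) (poly b (length (enc x))) (Q x))"

end

theory Submission
  imports Defs
begin

text \<open>
  Let t be the number of vertices of H. Guess, for every colour, the first t and the last t
  vertices that receive it, and colour the remaining vertices from left to right, remembering for
  every colour only the t vertices that received it most recently. It suffices to check every new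
  vertex against the at most 3t known vertices of its colour: if a monochromatic edge uv with u
  before v escapes this check, then t vertices of the same colour lie before u, t between u and v
  and t after v, and if v is chosen leftmost they induce, together with u and v, no edge but uv.
  Hence they contain H. For fixed k and t there are polynomially many states.
\<close>

text \<open>It is never verified that a guessed vertex receives its colour. What \<open>chk\<close>
  enforces suffices: every vertex of a colour is nonadjacent to all vertices guessed for it, and as
  soon as a vertex outside the guess receives the colour, the guess must consist of 2t pairwise
  nonadjacent vertices in increasing order, t on each side of that vertex. A class with at most 2t
  members is guessed completely, so it never has to meet the second demand. Both ends of an escaping
  edge lie outside the guess, since otherwise the check of the other end would meet the edge; and
  the left end has already dropped out of the window of the right end, which is why t vertices lie
  in between. These are nonadjacent to the right end by its check, and to each other and the left
  end because no monochromatic edge has an earlier right end. Keeping t vertices in each of the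
  three places, whatever the position of the edge in H, makes the program depend on k and t
  alone.\<close>

\<comment> \<open>Otherwise register 1 would be rewritten to Suc 0.\<close>
declare One_nat_def [simp del]

section \<open>Total correctness with running times\<close>

text \<open>
  The cost of a program is a polynomial in a number that bounds the iterations of every
  single execution of a loop; the rule for loops has to establish this bound.
\<close>

primrec cost :: "prog \<Rightarrow> nat poly" where
  "cost Skip = 1"
| "cost (Const x c) = 1"
| "cost (Add x y z) = 1"
| "cost (Sub x y z) = 1"
| "cost (Load x y) = 1"
| "cost (Store x y) = 1"
| "cost (Seq p q) = cost p + cost q"
| "cost (IfNZ x p q) = 1 + cost p + cost q"
| "cost (WhileNZ x p) = [:0, 1:] * (1 + cost p) + 1"

text \<open>An execution is asserted to exist, so termination is part of the claim. The time bound
  depends on the program text and \<open>l\<close> only, which keeps running times out of all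
  invariants and postconditions.\<close>

definition wp :: "nat \<Rightarrow> prog \<Rightarrow> (state \<Rightarrow> bool) \<Rightarrow> state \<Rightarrow> bool" where
  "wp l p Q s \<longleftrightarrow> (\<exists>t s'. exec p s t s' \<and> t \<le> poly (cost p) l \<and> Q s')"

lemma wp_mono: "wp l p Q s \<Longrightarrow> (\<And>r m. Q (r, m) \<Longrightarrow> Q' (r, m)) \<Longrightarrow> wp l p Q' s"
  unfolding wp_def by (metis surj_pair)

lemma wp_Skip [intro!]: "Q s \<Longrightarrow> wp l Skip Q s"
  unfolding wp_def by (rule exI, rule exI, rule conjI[OF exec.Skip]) simp

lemma wp_Const [intro!]: "Q (r(x := c), m) \<Longrightarrow> wp l (Const x c) Q (r, m)"
  unfolding wp_def by (rule exI, rule exI, rule conjI[OF exec.Const]) simp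

lemma wp_Add [intro!]: "Q (r(x := r y + r z), m) \<Longrightarrow> wp l (Add x y z) Q (r, m)"
  unfolding wp_def by (rule exI, rule exI, rule conjI[OF exec.Add]) simp

lemma wp_Sub [intro!]: "Q (r(x := r y - r z), m) \<Longrightarrow> wp l (Sub x y z) Q (r, m)"
  unfolding wp_def by (rule exI, rule exI, rule conjI[OF exec.Sub]) simp

lemma wp_Load [intro!]: "Q (r(x := m (r y)), m) \<Longrightarrow> wp l (Load x y) Q (r, m)"
  unfolding wp_def by (rule exI, rule exI, rule conjI[OF exec.Load]) simp

lemma wp_Store [intro!]: "Q (r, m(r x := r y)) \<Longrightarrow> wp l (Store x y) Q (r, m)"
  unfolding wp_def by (rule exI, rule exI, rule conjI[OF exec.Store]) simp

lemma wp_Seq [intro!]: "wp l p (wp l q Q) s \<Longrightarrow> wp l (Seq p q) Q s"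
  unfolding wp_def cost.simps poly_add by (meson exec.Seq add_mono)

lemma wp_IfNZ [intro!]:
  assumes "r x \<noteq> 0 \<Longrightarrow> wp l p Q (r, m)" and "r x = 0 \<Longrightarrow> wp l q Q (r, m)"
  shows "wp l (IfNZ x p q) Q (r, m)"
proof (cases "r x = 0")
  case True
  then obtain t s' where "exec q (r, m) t s'" "t \<le> poly (cost q) l" "Q s'"
    using assms(2) by (auto simp: wp_def)
  then show ?thesis
    using True exec.IfFalse[of "(r, m)" x q t s' p] unfolding wp_def
    by (intro exI[of _ "1 + t"] exI[of _ s']) auto
next
  case False
  then obtain t s' where "exec p (r, m) t s'" "t \<le> poly (cost p) l" "Q s'"
    using assms(1) by (auto simp: wp_def)
  then show ?thesis
    using False exec.IfTrue[of "(r, m)" x p t s' q] unfolding wp_def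
    by (intro exI[of _ "1 + t"] exI[of _ s']) auto
qed

text \<open>The number \<open>c\<close> of rounds is fixed in advance and the invariant is indexed
  by the rounds completed; the guard is nonzero at every stage before \<open>c\<close> and zero at
  stage \<open>c\<close>. As \<open>c\<close> is at most \<open>l\<close>, the factor
  \<open>[:0, 1:]\<close> in \<open>cost\<close> pays for all rounds, and nested loops share the
  same \<open>l\<close>.\<close>

lemma wp_WhileNZ:
  assumes "I 0 s" and "c \<le> l"
    and step: "\<And>i r m. i < c \<Longrightarrow> I i (r, m) \<Longrightarrow> r x \<noteq> 0 \<and> wp l p (I (Suc i)) (r, m)"
    and final: "\<And>r m. I c (r, m) \<Longrightarrow> r x = 0 \<and> Q (r, m)"
  shows "wp l (WhileNZ x p) Q s"
proof -
  have "\<exists>t s'. exec (WhileNZ x p) s t s' \<and> t \<le> d * (1 + poly (cost p) l) + 1 \<and> Q s'"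
    if "I (c - d) s" "d \<le> c" for d s
    using that
  proof (induction d arbitrary: s)
    case 0
    then have "fst s x = 0 \<and> Q s" using final[of "fst s" "snd s"] by simp
    then show ?case
      using exec.WhileFalse[of s x p] by (intro exI[of _ 1] exI[of _ s]) auto
  next
    case (Suc d)
    then have "fst s x \<noteq> 0" and "wp l p (I (Suc (c - Suc d))) s"
      using step[of "c - Suc d" "fst s" "snd s"] by auto
    moreover have "Suc (c - Suc d) = c - d" using Suc.prems by simp
    ultimately obtain t s1 where 1: "exec p s t s1" "t \<le> poly (cost p) l" "I (c - d) s1"
      by (auto simp: wp_def)
    then obtain t' s2 where "exec (WhileNZ x p) s1 t' s2" "t' \<le> d * (1 + poly (cost p) l) + 1" "Q s2"
      using Suc by (meson Suc_leD)
    then show ?case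
      using exec.WhileTrue[OF \<open>fst s x \<noteq> 0\<close> 1(1)] 1(2)
      by (intro exI[of _ "1 + t + t'"] exI[of _ s2]) auto
  qed
  from this[of c s] obtain t s' where "exec (WhileNZ x p) s t s'" "Q s'"
      "t \<le> c * (1 + poly (cost p) l) + 1"
    using assms(1) by auto
  moreover have "c * (1 + poly (cost p) l) \<le> l * (1 + poly (cost p) l)"
    using assms(2) by (rule mult_right_mono) simp
  ultimately have "t \<le> l * (1 + poly (cost p) l) + 1" by linarith
  then show ?thesis
    using \<open>exec (WhileNZ x p) s t s'\<close> \<open>Q s'\<close>
    unfolding wp_def by (intro exI[of _ t] exI[of _ s']) auto
qed


section \<open>Formulas and bounded loops\<close>

text \<open>
  Registers 1 to 4 are scratch. During the whole computation, registers 5 to 10 and 14 hold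
  1, n, n + 1, the length of the input (the start of the free memory), k, the address of the
  colour lists, and 0.
\<close>

definition horner :: "nat \<Rightarrow> nat \<Rightarrow> nat list \<Rightarrow> nat" where
  "horner b = foldl (\<lambda>a d. a * b + d)"

lemma horner_simps [simp]:
  "horner b a [] = a" "horner b a (d # ds) = horner b (a * b + d) ds"
  by (simp_all add: horner_def)

text \<open>A numeral in base \<open>b\<close> determines its digits: the induction hypothesis
  recovers the later digits and the number \<open>a * b + x\<close>, and division by
  \<open>b\<close> separates \<open>a\<close> from \<open>x\<close>. Distinct tuples will therefore
  get distinct table addresses.\<close>

lemma horner_inj:
  assumes "length xs = length ys" and "\<forall>x\<in>set xs \<union> set ys. x < b"
    and "horner b a xs = horner b a' ys"
  shows "a = a' \<and> xs = ys"
  using assms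
proof (induction xs ys arbitrary: a a' rule: list_induct2)
  case (Cons x xs y ys)
  have *: "a * b + x = a' * b + y \<and> xs = ys"
    by (rule Cons.IH) (use Cons.prems in auto)
  have lt: "x < b" "y < b" using Cons.prems by auto
  from * have "(a * b + x) div b = (a' * b + y) div b" by simp
  then have "a = a'" using lt by simp
  then show ?case using * by simp
qed simp

text \<open>Without a multiplication instruction, multiplying by the radix takes as many additions
  as the radix says, so the radix must not exceed \<open>l\<close>. Register 1 is the accumulator
  and is initialised by the caller.\<close>

primrec horner_prog :: "reg \<Rightarrow> reg list \<Rightarrow> prog" where
  "horner_prog b [] = Skip"
| "horner_prog b (d # ds) =
     Seq (Const 2 0) (Seq (Add 2 2 b) (Seq (Const 3 0)
       (Seq (WhileNZ 2 (Seq (Add 3 3 1) (Sub 2 2 5))) (Seq (Add 1 3 d) (horner_prog b ds)))))"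

definition same_from :: "reg \<Rightarrow> state \<Rightarrow> state \<Rightarrow> bool" where
  "same_from c s s' \<longleftrightarrow> snd s' = snd s \<and> (\<forall>x\<ge>c. fst s' x = fst s x)"

lemma wp_horner_prog:
  assumes "r b \<le> l" and "r 5 = 1" and "b \<ge> 5" and "\<forall>d\<in>set ds. d \<ge> 5"
  shows "wp l (horner_prog b ds)
     (\<lambda>s. same_from 5 (r, m) s \<and> fst s 1 = horner (r b) (r 1) (map r ds)) (r, m)"
  using assms
proof (induction ds arbitrary: r)
  case Nil
  show ?case by (auto simp: same_from_def)
next
  case (Cons d ds)
  have loop: "wp l (WhileNZ 2 (Seq (Add 3 3 1) (Sub 2 2 5)))
     (\<lambda>s. same_from 5 (r, m) s \<and> fst s 3 = r 1 * r b) (r(2 := r b, 3 := 0), m)"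
    by (rule wp_WhileNZ[where c = "r b" and I = "\<lambda>i s. same_from 5 (r, m) s \<and> fst s 1 = r 1 \<and>
          fst s 2 = r b - i \<and> fst s 3 = r 1 * i"])
      (use Cons.prems in \<open>auto simp: same_from_def algebra_simps\<close>)
  have rest: "wp l (horner_prog b ds)
      (\<lambda>s. same_from 5 (r, m) s \<and> fst s 1 = horner (r b) (r 1) (map r (d # ds))) (r', m')"
    if "same_from 5 (r, m) (r', m')" "r' 1 = r 1 * r b + r d" for r' m'
  proof -
    have eq: "m' = m" "r' b = r b" "r' 5 = r 5" "map r' ds = map r ds"
      using that Cons.prems by (auto simp: same_from_def)
    have "wp l (horner_prog b ds)
       (\<lambda>s. same_from 5 (r', m) s \<and> fst s 1 = horner (r' b) (r' 1) (map r' ds)) (r', m)"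
      by (rule Cons.IH) (use Cons.prems eq in auto)
    then show ?thesis
      unfolding eq
    proof (rule wp_mono)
      fix r2 m2
      assume "same_from 5 (r', m) (r2, m2) \<and> fst (r2, m2) 1 = horner (r b) (r' 1) (map r ds)"
      then show "same_from 5 (r, m) (r2, m2) \<and>
          fst (r2, m2) 1 = horner (r b) (r 1) (map r (d # ds))"
        using that by (simp add: same_from_def)
    qed
  qed
  show ?case
    unfolding horner_prog.simps
  proof (intro wp_Seq wp_Const wp_Add)
    show "wp l (WhileNZ 2 (Seq (Add 3 3 1) (Sub 2 2 5)))
      (wp l (Seq (Add 1 3 d) (horner_prog b ds))
        (\<lambda>s. same_from 5 (r, m) s \<and> fst s 1 = horner (r b) (r 1) (map r (d # ds))))
      (r(2 := 0, 2 := (r(2 := 0)) 2 + (r(2 := 0)) b, 3 := 0), m)"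
    proof -
      have "r(2 := 0, 2 := (r(2 := 0)) 2 + (r(2 := 0)) b, 3 := 0) = r(2 := r b, 3 := 0)"
        using Cons.prems by auto
      then show ?thesis
      proof (simp only:, intro wp_mono[OF loop] wp_Seq wp_Add)
        fix r' m' assume "same_from 5 (r, m) (r', m') \<and> fst (r', m') 3 = r 1 * r b"
        then show "wp l (horner_prog b ds)
          (\<lambda>s. same_from 5 (r, m) s \<and> fst s 1 = horner (r b) (r 1) (map r (d # ds)))
          (r'(1 := r' 3 + r' d), m')"
          using Cons.prems by (intro rest) (auto simp: same_from_def)
      qed
    qed
  qed
qed

text \<open>Tests are data, so that their programs are generated and verified once for all.
  \<open>Look c a b ds\<close> tests the memory cell at register \<open>a\<close> plus the constant
  \<open>c\<close> plus the numeral with digit registers \<open>ds\<close> and radix register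
  \<open>b\<close>. Quantifiers are absent because all ranges depend on k and t only and can be
  unrolled.\<close>

datatype fm = Lt reg reg | Look nat reg reg "reg list" | Neg fm | Conj fm fm

primrec holds :: "state \<Rightarrow> fm \<Rightarrow> bool" where
  "holds s (Lt x y) \<longleftrightarrow> fst s x < fst s y"
| "holds s (Look c a b ds) \<longleftrightarrow> snd s (fst s a + c + horner (fst s b) 0 (map (fst s) ds)) \<noteq> 0"
| "holds s (Neg f) \<longleftrightarrow> \<not> holds s f"
| "holds s (Conj f g) \<longleftrightarrow> holds s f \<and> holds s g"

text \<open>Operands avoid the scratch registers, which evaluation destroys. The radix is n, n + 1
  or k, so that its multiplication loops stay within \<open>l\<close>.\<close>

primrec wf_fm :: "fm \<Rightarrow> bool" where
  "wf_fm (Lt x y) \<longleftrightarrow> x \<ge> 5 \<and> y \<ge> 5"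
| "wf_fm (Look c a b ds) \<longleftrightarrow> a \<ge> 5 \<and> b \<in> {6, 7, 9} \<and> (\<forall>d\<in>set ds. d \<ge> 5)"
| "wf_fm (Neg f) \<longleftrightarrow> wf_fm f"
| "wf_fm (Conj f g) \<longleftrightarrow> wf_fm f \<and> wf_fm g"

lemma holds_cong:
  assumes "wf_fm f" and "same_from 5 s s'"
  shows "holds s' f \<longleftrightarrow> holds s f"
  using assms
proof (induction f)
  case (Look c a b ds)
  then have eq: "map (fst s') ds = map (fst s) ds" by (auto simp: same_from_def)
  have "fst s' a = fst s a" "fst s' b = fst s b" "snd s' = snd s"
    using Look by (auto simp: same_from_def)
  then show ?case by (simp add: eq)
qed (auto simp: same_from_def)

primrec test_prog :: "fm \<Rightarrow> prog" where
  "test_prog (Lt x y) = Sub 1 y x"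
| "test_prog (Look c a b ds) =
     Seq (Const 1 0) (Seq (horner_prog b ds)
       (Seq (Add 1 1 a) (Seq (Const 2 c) (Seq (Add 1 1 2) (Load 1 1)))))"
| "test_prog (Neg f) = Seq (test_prog f) (IfNZ 1 (Const 1 0) (Const 1 1))"
| "test_prog (Conj f g) = Seq (test_prog f) (IfNZ 1 (test_prog g) Skip)"

lemma wp_test_prog:
  assumes "wf_fm f" and "r 5 = 1" and "r 6 \<le> l" and "r 7 \<le> l" and "r 9 \<le> l"
  shows "wp l (test_prog f)
    (\<lambda>s. same_from 5 (r, m) s \<and> (fst s 1 \<noteq> 0 \<longleftrightarrow> holds (r, m) f)) (r, m)"
  using assms
proof (induction f arbitrary: r)
  case (Lt x y)
  then show ?case by (auto simp: same_from_def)
next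
  case (Look c a b ds)
  let ?r = "r(1 := 0)"
  have eq: "map ?r ds = map r ds" using Look by auto
  have "wp l (horner_prog b ds)
     (\<lambda>s. same_from 5 (?r, m) s \<and> fst s 1 = horner (?r b) (?r 1) (map ?r ds)) (?r, m)"
    by (rule wp_horner_prog) (use Look in auto)
  note * = this[unfolded eq]
  show ?case
    unfolding test_prog.simps
    apply (intro wp_Seq wp_Const)
    apply (rule wp_mono[OF *])
    apply (intro wp_Seq wp_Const wp_Add wp_Load)
    using Look.prems apply (auto simp: same_from_def ac_simps)
    done
next
  case (Neg f)
  then show ?case
    unfolding test_prog.simps
    apply (intro wp_Seq)
    apply (rule wp_mono[OF Neg.IH])
    by (auto simp: same_from_def)
next
  case (Conj f g)
  show ?case
    unfolding test_prog.simps
    apply (intro wp_Seq)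
    apply (rule wp_mono[OF Conj.IH(1)])
    using Conj.prems apply (auto)[5]
    apply (rule wp_IfNZ)
    subgoal for r' m'
      apply (rule wp_mono, unfold same_from_def fst_conv snd_conv, elim conjE, hypsubst)
       apply (rule Conj.IH(2))
      using Conj.prems apply (auto simp: same_from_def)[5]
      using holds_cong[of g "(r, m)" "(r', m)"] Conj.prems
      apply (auto simp: same_from_def)
      done
    by (auto simp: same_from_def)
qed

section \<open>Conditionals, counting loops and loops over all tuples\<close>

definition If_prog :: "fm \<Rightarrow> prog \<Rightarrow> prog \<Rightarrow> prog" where
  "If_prog f p q = Seq (test_prog f) (IfNZ 1 p q)"

lemma wp_If_prog:
  assumes "wf_fm f" and "r 5 = 1" and "r 6 \<le> l" and "r 7 \<le> l" and "r 9 \<le> l"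
    and "\<And>r'. same_from 5 (r, m) (r', m) \<Longrightarrow> holds (r, m) f \<Longrightarrow> wp l p Q (r', m)"
    and "\<And>r'. same_from 5 (r, m) (r', m) \<Longrightarrow> \<not> holds (r, m) f \<Longrightarrow> wp l q Q (r', m)"
  shows "wp l (If_prog f p q) Q (r, m)"
  unfolding If_prog_def
  apply (rule wp_Seq)
  apply (rule wp_mono[OF wp_test_prog])
  using assms by (auto simp: same_from_def)

definition For_prog :: "reg \<Rightarrow> prog \<Rightarrow> prog" where
  "For_prog x p = Seq (Const x 0) (Seq (Sub 1 7 x)
     (WhileNZ 1 (Seq p (Seq (Add x x 5) (Sub 1 7 x)))))"

text \<open>Register 1 is the guard: it is recomputed after every round as the truncated difference
  of register 7 and the counter. The invariant must therefore tolerate any value \<open>v\<close> in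
  it.\<close>

lemma wp_For_prog:
  assumes x: "x \<ge> 11" and N: "N \<le> l"
    and regs: "\<And>i r m. J i (r, m) \<Longrightarrow> r 5 = 1 \<and> r 7 = N"
    and start: "\<And>v. J 0 (r(x := 0, 1 := v), m)"
    and step: "\<And>i r m. i < N \<Longrightarrow> J i (r, m) \<Longrightarrow> r x = i \<Longrightarrow>
       wp l p (\<lambda>(r', m'). r' x = i \<and> (\<forall>v. J (Suc i) (r'(x := Suc i, 1 := v), m'))) (r, m)"
  shows "wp l (For_prog x p) (J N) (r, m)"
  unfolding For_prog_def
  apply (intro wp_Seq wp_Const wp_Sub)
  apply (rule wp_WhileNZ[where c = N and I = "\<lambda>i s. J i s \<and> fst s x = i \<and> fst s 1 = N - i"])
  subgoal using start[of "N"] regs[OF start[of 0]] x by auto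
  subgoal by (rule N)
  subgoal for i r m
    apply (intro conjI wp_Seq)
     apply simp
    apply (rule wp_mono[OF step])
    apply (auto)[3]
    subgoal for r' m'
      apply (intro wp_Seq wp_Add wp_Sub)
      using regs[of "Suc i" "r'(x := Suc i, 1 := 0)" m'] x by (auto simp flip: Suc_eq_plus1)
    done
  subgoal by auto
  done

primrec Nest_prog :: "reg list \<Rightarrow> prog \<Rightarrow> prog" where
  "Nest_prog [] p = p"
| "Nest_prog (x # xs) p = For_prog x (Nest_prog xs p)"

definition tuples :: "nat \<Rightarrow> nat \<Rightarrow> nat list set" where
  "tuples d n = {ys. length ys = d \<and> set ys \<subseteq> {0..n}}"

lemma tuples_0: "tuples 0 n = {[]}"
  by (auto simp: tuples_def)

lemma tuples_Suc: "tuples (Suc d) n = (\<Union>y<Suc n. (#) y ` tuples d n)"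
  by (fastforce simp: tuples_def length_Suc_conv image_iff)

text \<open>\<open>J\<close> is indexed by the set of tuples visited so far, so the body need not
  know their order. While the outer counter is \<open>i\<close>, the inductive step uses the
  invariant for all tuples with a smaller head together with those with head \<open>i\<close> whose
  tail has been visited in this round.\<close>

lemma wp_Nest_prog:
  assumes "distinct xs" and "\<forall>x\<in>set xs. x \<ge> 11" and "Suc n \<le> l"
    and "\<And>A r m. J A (r, m) \<Longrightarrow> r 5 = 1 \<and> r 7 = Suc n"
    and "\<And>A r m x v. J A (r, m) \<Longrightarrow> x \<in> insert 1 (set xs) \<Longrightarrow> J A (r(x := v), m)"
    and "\<And>A r m. J A (r, m) \<Longrightarrow> map r xs \<in> tuples (length xs) n \<Longrightarrow>
       wp l p (\<lambda>(r', m'). map r' xs = map r xs \<and> J (insert (map r xs) A) (r', m')) (r, m)"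
    and "J {} (r, m)"
  shows "wp l (Nest_prog xs p) (J (tuples (length xs) n)) (r, m)"
  using assms
proof (induction xs arbitrary: J r m)
  case Nil
  show ?case using Nil.prems(6)[OF Nil.prems(7)]
    by (auto simp: tuples_0 elim!: wp_mono)
next
  case (Cons x xs)
  let ?T = "tuples (length xs) n"
  let ?J = "\<lambda>i A s. fst s x = i \<and> J ((\<Union>y<i. (#) y ` ?T) \<union> (#) i ` A) s"
  note ne = Cons.prems(1,2)
  have step: "wp l (Nest_prog xs p) (?J i ?T) (r, m)" if "i < Suc n" "?J i {} (r, m)" for i r m
  proof (rule Cons.IH[where J = "?J i"])
    show "distinct xs" "\<forall>x\<in>set xs. 11 \<le> x" "Suc n \<le> l" using Cons.prems by auto
    show "r 5 = 1 \<and> r 7 = Suc n" if "?J i A (r, m)" for A r m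
      using that Cons.prems(4) by auto
    show "?J i A (r(z := v), m)" if "?J i A (r, m)" "z \<in> insert 1 (set xs)" for A r m z v
      using that ne by (auto intro!: Cons.prems(5))
    show "wp l p (\<lambda>(r', m'). map r' xs = map r xs \<and> ?J i (insert (map r xs) A) (r', m')) (r, m)"
      if "?J i A (r, m)" "map r xs \<in> ?T" for A r m
      using that \<open>i < Suc n\<close>
      by (auto intro!: wp_mono[OF Cons.prems(6)] simp: tuples_def)
    show "?J i {} (r, m)" by fact
  qed
  let ?K = "\<lambda>i s. J (\<Union>y<i. (#) y ` ?T) s"
  have "wp l (For_prog x (Nest_prog xs p)) (?K (Suc n)) (r, m)"
  proof (rule wp_For_prog)
    show "11 \<le> x" "Suc n \<le> l" using Cons.prems by auto
    show "r 5 = 1 \<and> r 7 = Suc n" if "?K i (r, m)" for i r m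
      using that by (rule Cons.prems(4))
    show "?K 0 (r(x := 0, 1 := v), m)" for v
      using Cons.prems(7) by (auto intro!: Cons.prems(5))
    show "wp l (Nest_prog xs p)
        (\<lambda>(r', m'). r' x = i \<and> (\<forall>v. ?K (Suc i) (r'(x := Suc i, 1 := v), m'))) (r, m)"
      if "i < Suc n" "?K i (r, m)" "r x = i" for i r m
    proof (rule wp_mono[OF step])
      show "i < Suc n" "?J i {} (r, m)" using that by auto
      fix r' m' assume "?J i ?T (r', m')"
      moreover have "(\<Union>y<Suc i. (#) y ` ?T) = (\<Union>y<i. (#) y ` ?T) \<union> (#) i ` ?T"
        by (simp add: lessThan_Suc Un_commute)
      ultimately have "r' x = i" "?K (Suc i) (r', m')" by auto
      then show "case (r', m') of (r', m') \<Rightarrow>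
          r' x = i \<and> (\<forall>v. ?K (Suc i) (r'(x := Suc i, 1 := v), m'))"
        by (auto intro!: Cons.prems(5))
    qed
  qed
  then show ?case by (simp add: tuples_Suc)
qed


section \<open>The dynamic program\<close>

text \<open>
  A tuple has, for each of the k colours, a block of 3t entries: a guess for the first t
  vertices of that colour, a guess for the last t, and the t most recent vertices of that colour,
  the latest one first. The value n stands for an empty entry.
\<close>

locale dp =
  fixes k t n :: nat and adj :: "nat \<Rightarrow> nat \<Rightarrow> bool" and avail :: "nat \<Rightarrow> nat \<Rightarrow> bool"
begin

text \<open>The bounds matter because \<open>n\<close> marks an empty entry, where
  \<open>adj\<close> is arbitrary.\<close>

definition nb :: "nat \<Rightarrow> nat \<Rightarrow> bool" where
  "nb x y \<longleftrightarrow> x < n \<and> y < n \<and> adj x y"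

definition entry :: "nat list \<Rightarrow> nat \<Rightarrow> nat \<Rightarrow> nat" where
  "entry ys i j = ys ! (3 * t * i + j)"

definition dim :: nat where
  "dim = 3 * t * k"

text \<open>The 3t entries comprise guesses on both sides of \<open>p\<close> as well as the window.
  The disjunction exempts guessed vertices; any other vertex requires the full reservoir of 2t
  vertices from which a copy of H can be completed.\<close>

definition chk :: "nat \<Rightarrow> nat \<Rightarrow> nat list \<Rightarrow> bool" where
  "chk i p ys \<longleftrightarrow> avail i p \<and> (\<forall>j<3*t. \<not> nb p (entry ys i j)) \<and>
     ((\<exists>j<2*t. p = entry ys i j) \<or>
      (\<forall>j<t. entry ys i j < p) \<and> (\<forall>j<t. p < entry ys i (t + j)) \<and>
      (\<forall>j<2*t. entry ys i j < n \<and>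
         (\<forall>j'<j. entry ys i j' < entry ys i j \<and> \<not> nb (entry ys i j') (entry ys i j))))"

definition upd :: "nat \<Rightarrow> nat \<Rightarrow> nat list \<Rightarrow> nat list" where
  "upd i p ys = map (\<lambda>j. if j = 3*t*i + 2*t then p
     else if 3*t*i + 2*t < j \<and> j < 3*t*i + 3*t then ys ! (j - 1) else ys ! j) [0..<dim]"

text \<open>Nondeterminism becomes one initial state per guess; only the windows are forced to be
  empty.\<close>

definition start :: "nat list set" where
  "start = {ys \<in> tuples dim n. \<forall>i<k. \<forall>j<t. entry ys i (2*t + j) = n}"

definition succs :: "nat \<Rightarrow> nat list set \<Rightarrow> nat list set" where
  "succs p A = {upd i p ys | i ys. i < k \<and> p < n \<and> ys \<in> A \<and> chk i p ys}"

primrec reach :: "nat \<Rightarrow> nat list set" where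
  "reach 0 = start"
| "reach (Suc p) = succs p (reach p)"

lemma slot_less_dim: "i < k \<Longrightarrow> j < 3 * t \<Longrightarrow> 3 * t * i + j < dim"
proof -
  assume "i < k" "j < 3 * t"
  then have "3 * t * i + j < 3 * t * Suc i" by simp
  also have "\<dots> \<le> dim" unfolding dim_def using \<open>i < k\<close> by (intro mult_left_mono) auto
  finally show ?thesis .
qed

lemma upd_in_tuples:
  assumes ys: "ys \<in> tuples dim n" and "p < n"
  shows "upd i p ys \<in> tuples dim n"
proof -
  have "ys ! j \<le> n" if "j < dim" for j
  proof -
    have "ys ! j \<in> set ys" using ys that by (auto simp: tuples_def)
    then show ?thesis using ys by (auto simp: tuples_def)
  qed
  then show ?thesis
    using \<open>p < n\<close> by (auto simp: tuples_def upd_def)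
qed

lemma reach_subset: "reach p \<subseteq> tuples dim n"
  by (induction p) (auto simp: start_def succs_def upd_in_tuples)

end


section \<open>The program\<close>

fun conjs :: "fm list \<Rightarrow> fm" where
  "conjs [] = Neg (Lt 5 5)"
| "conjs (f # fs) = Conj f (conjs fs)"

definition disjs :: "fm list \<Rightarrow> fm" where
  "disjs fs = Neg (conjs (map Neg fs))"

lemma holds_conjs [simp]: "holds s (conjs fs) \<longleftrightarrow> (\<forall>f\<in>set fs. holds s f)"
  by (induction fs) auto

lemma holds_disjs [simp]: "holds s (disjs fs) \<longleftrightarrow> (\<exists>f\<in>set fs. holds s f)"
  by (auto simp: disjs_def)

lemma wf_conjs [simp]: "wf_fm (conjs fs) \<longleftrightarrow> (\<forall>f\<in>set fs. wf_fm f)"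
  by (induction fs) auto

lemma wf_disjs [simp]: "wf_fm (disjs fs) \<longleftrightarrow> (\<forall>f\<in>set fs. wf_fm f)"
  by (auto simp: disjs_def)

text \<open>
  Register 11 collects the answer, register 12 holds the current vertex and register 13 the next
  one. The tuple is held in the registers from 20 on.
\<close>

definition nb_fm :: "reg \<Rightarrow> reg \<Rightarrow> fm" where
  "nb_fm x y = conjs [Lt x 6, Lt y 6, Look 0 7 6 [x, y]]"

definition eq_fm :: "reg \<Rightarrow> reg \<Rightarrow> fm" where
  "eq_fm x y = Conj (Neg (Lt x y)) (Neg (Lt y x))"

definition slot :: "nat \<Rightarrow> nat \<Rightarrow> nat \<Rightarrow> reg" where
  "slot t i j = 20 + (3 * t * i + j)"

text \<open>In the lookup of the list, register 14 holds 0 and serves as last digit, so that the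
  numeral is the vertex times k; the colour \<open>i\<close> is a constant of the program and enters
  as the offset.\<close>

definition chk_fm :: "nat \<Rightarrow> nat \<Rightarrow> fm" where
  "chk_fm t i = conjs
     [Look i 10 9 [12, 14],
      conjs (map (\<lambda>j. Neg (nb_fm 12 (slot t i j))) [0..<3*t]),
      disjs
        [disjs (map (\<lambda>j. eq_fm 12 (slot t i j)) [0..<2*t]),
         conjs
          [conjs (map (\<lambda>j. Lt (slot t i j) 12) [0..<t]),
           conjs (map (\<lambda>j. Lt 12 (slot t i (t + j))) [0..<t]),
           conjs (map (\<lambda>j. Conj (Lt (slot t i j) 6)
             (conjs (map (\<lambda>j'. Conj (Lt (slot t i j') (slot t i j))
                (Neg (nb_fm (slot t i j') (slot t i j)))) [0..<j]))) [0..<2*t])]]]"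

definition slots :: "nat \<Rightarrow> nat \<Rightarrow> reg list" where
  "slots k t = [20..<20 + 3 * t * k]"

text \<open>Row 0 is never stored: the tuples of \<open>start\<close> are recognised by their empty
  windows. All other rows are read from the table.\<close>

definition reach_fm :: "nat \<Rightarrow> nat \<Rightarrow> fm" where
  "reach_fm k t = disjs
     [conjs [eq_fm 12 14,
        conjs (map (\<lambda>i. conjs (map (\<lambda>j. eq_fm (slot t i (2*t + j)) 6) [0..<t])) [0..<k])],
      Look 0 8 7 (12 # slots k t)]"

text \<open>The registers of the tuple are also the loop counters and must stay intact. So
  \<open>upd\<close> is never carried out; the address of the new tuple is computed from a
  rearranged list of registers.\<close>

definition shifted :: "nat \<Rightarrow> nat \<Rightarrow> nat \<Rightarrow> reg list" where
  "shifted k t i = map (\<lambda>j. if j = 3*t*i + 2*t then 12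
     else if 3*t*i + 2*t < j \<and> j < 3*t*i + 3*t then 20 + (j - 1) else 20 + j) [0..<3*t*k]"

definition mark_prog :: "nat \<Rightarrow> nat \<Rightarrow> nat \<Rightarrow> prog" where
  "mark_prog k t i = If_prog (chk_fm t i)
     (Seq (Const 1 0) (Seq (horner_prog 7 (13 # shifted k t i)) (Seq (Add 1 1 8) (Store 1 5))))
     Skip"

definition seqs :: "prog list \<Rightarrow> prog" where
  "seqs ps = foldr Seq ps Skip"

text \<open>In round n of the main loop no vertex is left to colour, and any reachable tuple
  certifies success.\<close>

definition body_prog :: "nat \<Rightarrow> nat \<Rightarrow> prog" where
  "body_prog k t = If_prog (reach_fm k t)
     (If_prog (Lt 12 6) (seqs (map (mark_prog k t) [0..<k])) (Const 11 1)) Skip"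

definition main_prog :: "nat \<Rightarrow> nat \<Rightarrow> prog" where
  "main_prog k t = For_prog 12 (Seq (Add 13 12 5) (Nest_prog (slots k t) (body_prog k t)))"

text \<open>Register 6 is counter and address at once, so the scan of the unary prefix stops at its
  zero bit with n in this register. The numeral with digits n and n + 1 in base n is n * n + n + 1,
  the address of the lists.\<close>

definition init_prog :: "nat \<Rightarrow> prog" where
  "init_prog k = seqs [Const 5 1, Add 8 8 0, Load 2 6,
     WhileNZ 2 (Seq (Add 6 6 5) (Load 2 6)), Add 7 6 5, Const 9 k,
     Const 1 0, horner_prog 6 [6, 7], Add 10 10 1]"

definition coloring_prog :: "nat \<Rightarrow> nat \<Rightarrow> prog" where
  "coloring_prog k t = Seq (init_prog k) (Seq (main_prog k t) (Seq (Const 0 0) (Add 0 0 11)))"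

section \<open>The program implements the dynamic program\<close>

locale ram = dp +
  fixes l B :: nat
  assumes n_less_l: "n < l" and k_le_l: "k \<le> l"
    and B: "B \<ge> n * n + n + 1 + n * k"
begin

text \<open>The input stays in place below \<open>B\<close>, and the table of reachable tuples
  begins at \<open>B\<close>. Hence marking a tuple never disturbs the last two conjuncts.\<close>

definition env :: "state \<Rightarrow> bool" where
  "env s \<longleftrightarrow> fst s 5 = 1 \<and> fst s 6 = n \<and> fst s 7 = Suc n \<and> fst s 8 = B \<and> fst s 9 = k \<and>
     fst s 10 = n * n + n + 1 \<and> fst s 14 = 0 \<and>
     (\<forall>u<n. \<forall>v<n. snd s (Suc n + (u * n + v)) \<noteq> 0 \<longleftrightarrow> adj u v) \<and>
     (\<forall>v<n. \<forall>i<k. snd s (n * n + n + 1 + (v * k + i)) \<noteq> 0 \<longleftrightarrow> avail i v)"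

lemma env_upd [simp]: "x \<notin> {5,6,7,8,9,10,14} \<Longrightarrow> env (r(x := v), m) \<longleftrightarrow> env (r, m)"
  by (simp add: env_def)

lemma env_cong: "same_from 5 (r, m) (r', m) \<Longrightarrow> env (r', m) \<longleftrightarrow> env (r, m)"
  by (simp add: env_def same_from_def)

lemma adj_addr_less:
  assumes "u < n" "v < n"
  shows "Suc n + (u * n + v) < B"
proof -
  have "u * n + v < Suc u * n" using assms by simp
  also have "\<dots> \<le> n * n" using assms by (intro mult_right_mono) auto
  finally show ?thesis using B by simp
qed

lemma avail_addr_less:
  assumes "v < n" "i < k"
  shows "n * n + n + 1 + (v * k + i) < B"
proof -
  have "v * k + i < Suc v * k" using assms by simp
  also have "\<dots> \<le> n * k" using assms by (intro mult_right_mono) auto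
  finally show ?thesis using B by simp
qed

lemma env_mem_upd:
  assumes "a \<ge> B" "env (r, m)"
  shows "env (r, m(a := v))"
proof -
  have "Suc n + (u * n + v) \<noteq> a" if "u < n" "v < n" for u v
    using adj_addr_less[OF that] assms(1) by simp
  moreover have "n * n + n + 1 + (v * k + i) \<noteq> a" if "v < n" "i < k" for v i
    using avail_addr_less[OF that] assms(1) by simp
  ultimately show ?thesis using assms(2) by (auto simp: env_def)
qed

abbreviation tup :: "(reg \<Rightarrow> nat) \<Rightarrow> nat list" where
  "tup r \<equiv> map r (slots k t)"

lemma tup_nth: "j < dim \<Longrightarrow> tup r ! j = r (20 + j)"
  by (simp add: slots_def dim_def)

lemma entry_tup: "i < k \<Longrightarrow> j < 3 * t \<Longrightarrow> entry (tup r) i j = r (slot t i j)"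
  using slot_less_dim[of i j] by (simp add: entry_def tup_nth slot_def)

lemma holds_nb_fm [simp]:
  "env (r, m) \<Longrightarrow> holds (r, m) (nb_fm x y) \<longleftrightarrow> nb (r x) (r y)"
  by (auto simp: nb_fm_def nb_def env_def)

lemma holds_eq_fm [simp]: "holds (r, m) (eq_fm x y) \<longleftrightarrow> r x = r y"
  by (auto simp: eq_fm_def)

lemma wf_chk_fm [simp]: "wf_fm (chk_fm t i)"
  by (auto simp: chk_fm_def slot_def nb_fm_def eq_fm_def)

lemma holds_chk_fm:
  assumes "env (r, m)" "i < k" "r 12 < n"
  shows "holds (r, m) (chk_fm t i) \<longleftrightarrow> chk i (r 12) (tup r)"
proof -
  have "r 10 + i + horner (r 9) 0 (map r [12, 14]) = n * n + n + 1 + (r 12 * k + i)"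
    using assms(1) by (simp add: env_def)
  then have a: "holds (r, m) (Look i 10 9 [12, 14]) \<longleftrightarrow> avail i (r 12)"
    using assms by (simp only: holds.simps fst_conv snd_conv env_def)
  have "r 6 = n" using assms(1) by (simp add: env_def)
  then show ?thesis
    unfolding chk_fm_def chk_def using assms(1,2)
    by (simp add: a entry_tup del: holds.simps(2) cong: conj_cong)
      (auto simp add: entry_tup)
qed

definition addr :: "nat \<Rightarrow> nat list \<Rightarrow> nat" where
  "addr p ys = B + horner (Suc n) 0 (p # ys)"

lemma addr_inj:
  assumes "addr p ys = addr q zs" "p \<le> n" "q \<le> n" "ys \<in> tuples dim n" "zs \<in> tuples dim n"
  shows "p = q \<and> ys = zs"
  using horner_inj[of "p # ys" "q # zs" "Suc n" 0 0] assms
  by (fastforce simp: addr_def tuples_def less_Suc_eq_le)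

definition marked :: "(nat \<times> nat list) set \<Rightarrow> state \<Rightarrow> bool" where
  "marked M s \<longleftrightarrow> M \<subseteq> {..n} \<times> tuples dim n \<and>
     (\<forall>p\<le>n. \<forall>ys\<in>tuples dim n. snd s (addr p ys) \<noteq> 0 \<longleftrightarrow> (p, ys) \<in> M)"

lemma marked_upd [simp]: "marked M (r(x := v), m) \<longleftrightarrow> marked M (r, m)"
  by (simp add: marked_def)

lemma marked_mem_upd:
  assumes "marked M (r, m)" "p \<le> n" "ys \<in> tuples dim n"
  shows "marked (insert (p, ys) M) (r', m(addr p ys := 1))"
  using assms addr_inj[OF _ _ assms(2) _ assms(3)] by (auto simp: marked_def)

lemma wf_reach_fm [simp]: "wf_fm (reach_fm k t)"
  by (auto simp: reach_fm_def slot_def slots_def eq_fm_def)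

lemma holds_reach_fm:
  assumes "env (r, m)" "marked M (r, m)" "r 12 \<le> n" "tup r \<in> tuples dim n"
    and "\<And>ys. (r 12, ys) \<in> M \<longleftrightarrow> r 12 > 0 \<and> ys \<in> reach (r 12)"
  shows "holds (r, m) (reach_fm k t) \<longleftrightarrow> tup r \<in> reach (r 12)"
proof -
  have "holds (r, m) (Look 0 8 7 (12 # slots k t)) \<longleftrightarrow> (r 12, tup r) \<in> M"
    using assms by (auto simp: marked_def addr_def env_def)
  moreover have "tup r \<in> start \<longleftrightarrow> (\<forall>i<k. \<forall>j<t. r (slot t i (2*t+j)) = n)"
    using assms(4) by (auto simp: start_def entry_tup)
  moreover have "r 6 = n" "r 14 = 0" using assms(1) by (auto simp: env_def)
  ultimately show ?thesis
    unfolding reach_fm_def using assms(5)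
    by (cases "r 12") (auto simp del: holds.simps(2))
qed

lemma map_shifted: "map r (shifted k t i) = upd i (r 12) (tup r)"
  by (auto simp: shifted_def upd_def dim_def tup_nth[unfolded dim_def])

text \<open>The comprehension over \<open>z\<close> is a singleton or empty according to the check,
  which lets one postcondition cover both branches.\<close>

lemma wp_mark_prog:
  assumes "env (r, m)" "marked M (r, m)" "r 12 < n" "r 13 = Suc (r 12)"
    "tup r \<in> tuples dim n" "i < k"
  shows "wp l (mark_prog k t i) (\<lambda>s. env s \<and> (\<forall>x\<ge>5. fst s x = r x) \<and>
    marked (M \<union> {z. z = (Suc (r 12), upd i (r 12) (tup r)) \<and> chk i (r 12) (tup r)}) s) (r, m)"
  unfolding mark_prog_def
proof (rule wp_If_prog)
  have e: "r 5 = 1" "r 7 = Suc n" "r 8 = B" using assms(1) by (auto simp: env_def)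
  show "r 6 \<le> l" "r 7 \<le> l" "r 9 \<le> l" "r 5 = 1" "wf_fm (chk_fm t i)"
    using assms(1) n_less_l k_le_l by (auto simp: env_def)
  fix r'
  assume s: "same_from 5 (r, m) (r', m)"
  then have s': "\<forall>x\<ge>5. r' x = r x" by (simp add: same_from_def)
  have env': "env (r', m)" using s assms(1) by (simp add: env_cong)
  { assume "\<not> holds (r, m) (chk_fm t i)"
    then show "wp l Skip (\<lambda>s. env s \<and> (\<forall>x\<ge>5. fst s x = r x) \<and>
       marked (M \<union> {z. z = (Suc (r 12), upd i (r 12) (tup r)) \<and> chk i (r 12) (tup r)}) s) (r', m)"
      using s' env' assms by (auto simp: holds_chk_fm marked_def) }
  assume "holds (r, m) (chk_fm t i)"
  then have chk: "chk i (r 12) (tup r)" using assms by (simp add: holds_chk_fm)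
  let ?r = "r'(1 := 0)"
  have ge: "\<forall>d\<in>set (13 # shifted k t i). 5 \<le> d" by (auto simp: shifted_def)
  then have "map ?r (13 # shifted k t i) = map r (13 # shifted k t i)"
    using s' by (intro map_cong) auto
  then have eq: "map ?r (13 # shifted k t i) = Suc (r 12) # upd i (r 12) (tup r)"
    using assms(4) by (simp add: map_shifted)
  have h: "wp l (horner_prog 7 (13 # shifted k t i))
     (\<lambda>s. same_from 5 (?r, m) s \<and> fst s 1 = horner (?r 7) (?r 1) (map ?r (13 # shifted k t i)))
     (?r, m)"
    by (rule wp_horner_prog) (use ge s' e n_less_l in auto)
  show "wp l (Seq (Const 1 0) (Seq (horner_prog 7 (13 # shifted k t i)) (Seq (Add 1 1 8) (Store 1 5))))
     (\<lambda>s. env s \<and> (\<forall>x\<ge>5. fst s x = r x) \<and>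
       marked (M \<union> {z. z = (Suc (r 12), upd i (r 12) (tup r)) \<and> chk i (r 12) (tup r)}) s) (r', m)"
    apply (intro wp_Seq wp_Const)
    apply (rule wp_mono[OF h[unfolded eq]])
    apply (intro wp_Seq wp_Add wp_Store)
    subgoal for r2 m2
    proof -
      assume a: "same_from 5 (?r, m) (r2, m2) \<and>
        fst (r2, m2) 1 = horner (?r 7) (?r 1) (Suc (r 12) # upd i (r 12) (tup r))"
      then have m2: "m2 = m" and r2: "\<forall>x\<ge>5. r2 x = r x" using s' by (auto simp: same_from_def)
      have ad: "r2 1 + r2 8 = addr (Suc (r 12)) (upd i (r 12) (tup r))"
        using a r2 s' e by (simp add: addr_def)
      have "env (r2, m)" using r2 env_cong[of r m r2] assms(1) by (simp add: same_from_def)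
      then have "env (r2(1 := r2 1 + r2 8), m(r2 1 + r2 8 := 1))"
        by (intro env_mem_upd) (auto simp: ad addr_def)
      moreover have "marked (insert (Suc (r 12), upd i (r 12) (tup r)) M)
          (r2(1 := r2 1 + r2 8), m(r2 1 + r2 8 := 1))"
        unfolding ad by (rule marked_mem_upd[OF assms(2)]) (use assms in \<open>auto simp: upd_in_tuples\<close>)
      ultimately show ?thesis using m2 r2 e chk by simp
    qed
    done
qed

lemma wp_seqs_mark_prog:
  assumes "env (r, m)" "marked M (r, m)" "r 12 < n" "r 13 = Suc (r 12)"
    "tup r \<in> tuples dim n" "set is \<subseteq> {..<k}"
  shows "wp l (seqs (map (mark_prog k t) is)) (\<lambda>s. env s \<and> (\<forall>x\<ge>5. fst s x = r x) \<and>
    marked (M \<union> {(Suc (r 12), upd i (r 12) (tup r)) |i. i \<in> set is \<and> chk i (r 12) (tup r)}) s) (r, m)"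
  using assms
proof (induction "is" arbitrary: r m M)
  case Nil
  then show ?case by (auto simp: seqs_def)
next
  case (Cons i "is")
  have 1: "wp l (mark_prog k t i) (\<lambda>s. env s \<and> (\<forall>x\<ge>5. fst s x = r x) \<and>
    marked (M \<union> {z. z = (Suc (r 12), upd i (r 12) (tup r)) \<and> chk i (r 12) (tup r)}) s) (r, m)"
    by (rule wp_mark_prog) (use Cons.prems in auto)
  show ?case
    unfolding seqs_def list.map foldr.simps o_def
    apply (rule wp_Seq)
    apply (rule wp_mono[OF 1])
    subgoal for r' m'
    proof -
      assume a: "env (r', m') \<and> (\<forall>x\<ge>5. fst (r', m') x = r x) \<and>
        marked (M \<union> {z. z = (Suc (r 12), upd i (r 12) (tup r)) \<and> chk i (r 12) (tup r)}) (r', m')"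
      then have r': "r' 12 = r 12" "r' 13 = r 13" by auto
      have tup: "tup r' = tup r" using a by (auto simp: slots_def)
      then have tin: "tup r' \<in> tuples dim n" using Cons.prems by (simp only:)
      have "wp l (seqs (map (mark_prog k t) is)) (\<lambda>s. env s \<and> (\<forall>x\<ge>5. fst s x = r' x) \<and>
        marked (M \<union> {z. z = (Suc (r 12), upd i (r 12) (tup r)) \<and> chk i (r 12) (tup r)} \<union>
           {(Suc (r' 12), upd i (r' 12) (tup r')) |i. i \<in> set is \<and> chk i (r' 12) (tup r')}) s) (r', m')"
        by (rule Cons.IH) (use a r' tin Cons.prems in auto)
      moreover have "M \<union> {z. z = (Suc (r 12), upd i (r 12) (tup r)) \<and> chk i (r 12) (tup r)} \<union>
          {(Suc (r 12), upd i (r 12) (tup r)) |i. i \<in> set is \<and> chk i (r 12) (tup r)} =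
          M \<union> {(Suc (r 12), upd j (r 12) (tup r)) |j. j \<in> set (i # is) \<and> chk j (r 12) (tup r)}"
        by auto
      moreover have "(\<forall>x\<ge>5. fst s x = r' x) \<longleftrightarrow> (\<forall>x\<ge>5. fst s x = r x)" for s :: state
        using a by auto
      ultimately have "wp l (seqs (map (mark_prog k t) is)) (\<lambda>s. env s \<and> (\<forall>x\<ge>5. fst s x = r x) \<and>
         marked (M \<union> {(Suc (r 12), upd j (r 12) (tup r)) |j.
           j \<in> set (i # is) \<and> chk j (r 12) (tup r)}) s) (r', m')"
        unfolding r' tup by (simp only:)
      then show ?thesis by (simp add: seqs_def)
    qed
    done
qed

text \<open>Contents of the table while row \<open>p\<close> is processed and the tuples in
  \<open>A\<close> are done: rows 1 to \<open>p\<close> are final, and row \<open>p + 1\<close>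
  holds the successors found so far.\<close>

definition table :: "nat \<Rightarrow> nat list set \<Rightarrow> (nat \<times> nat list) set" where
  "table p A = {(q, ys). 0 < q \<and> q \<le> p \<and> q \<le> n \<and> ys \<in> reach q} \<union>
     (if p < n then {Suc p} \<times> succs p (A \<inter> reach p) else {})"

definition inv :: "nat \<Rightarrow> nat list set \<Rightarrow> state \<Rightarrow> bool" where
  "inv p A s \<longleftrightarrow> env s \<and> fst s 12 = p \<and> fst s 13 = Suc p \<and> marked (table p A) s \<and>
     fst s 11 = of_bool (p > n \<and> reach n \<noteq> {} \<or> p = n \<and> A \<inter> reach n \<noteq> {})"

lemma succs_insert: "succs p (insert ys A) = succs p {ys} \<union> succs p A"
  by (auto simp: succs_def)

text \<open>\<open>A\<close> enters the invariant only through its intersection with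
  \<open>reach p\<close>, so skipping an unreachable tuple preserves it. A reachable one adds its
  successors to the table or, if \<open>p = n\<close>, sets the answer.\<close>

lemma wp_body_prog:
  assumes inv: "inv p A (r, m)" and ys: "tup r = ys" "ys \<in> tuples dim n" and p: "p \<le> n"
  shows "wp l (body_prog k t) (\<lambda>(r', m'). tup r' = ys \<and> inv p (insert ys A) (r', m')) (r, m)"
proof -
  note inv' = inv[unfolded inv_def fst_conv]
  have e: "r 5 = 1" "r 6 = n" "r 7 = Suc n" "r 9 = k" using inv' by (auto simp: env_def)
  have pos: "r' 12 = p \<and> r' 13 = Suc p \<and> r' 11 = r 11 \<and> tup r' = ys \<and> env (r', m) \<and>
      marked (table p A) (r', m)"
    if "same_from 5 (r, m) (r', m)" for r'
    using that inv' ys env_cong[OF that] by (auto simp: same_from_def slots_def marked_def)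
  have M: "(p, zs) \<in> table p A \<longleftrightarrow> 0 < p \<and> zs \<in> reach p" for zs
    using p by (auto simp: table_def)
  have reach: "holds (r, m) (reach_fm k t) \<longleftrightarrow> ys \<in> reach p"
    using holds_reach_fm[of r m "table p A"] inv' ys M p by auto
  show ?thesis
    unfolding body_prog_def
  proof (rule wp_If_prog)
    show "r 6 \<le> l" "r 7 \<le> l" "r 9 \<le> l" "r 5 = 1" "wf_fm (reach_fm k t)"
      using e n_less_l k_le_l by auto
  next
    fix r' assume s: "same_from 5 (r, m) (r', m)" and "\<not> holds (r, m) (reach_fm k t)"
    then have no: "ys \<notin> reach p" using reach by simp
    show "wp l Skip (\<lambda>(r', m'). tup r' = ys \<and> inv p (insert ys A) (r', m')) (r', m)"
      using pos[OF s] no inv' by (auto simp: inv_def table_def)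
  next
    fix r1 assume s1: "same_from 5 (r, m) (r1, m)" and "holds (r, m) (reach_fm k t)"
    then have yes: "ys \<in> reach p" using reach by simp
    have e1: "r1 5 = 1" "r1 6 = n" "r1 7 = Suc n" "r1 9 = k"
      using s1 e by (auto simp: same_from_def)
    show "wp l (If_prog (Lt 12 6) (seqs (map (mark_prog k t) [0..<k])) (Const 11 1))
        (\<lambda>(r', m'). tup r' = ys \<and> inv p (insert ys A) (r', m')) (r1, m)"
    proof (rule wp_If_prog)
      show "r1 6 \<le> l" "r1 7 \<le> l" "r1 9 \<le> l" "r1 5 = 1" "wf_fm (Lt 12 6)"
        using e1 n_less_l k_le_l by auto
    next
      fix r' assume "same_from 5 (r1, m) (r', m)" and "\<not> holds (r1, m) (Lt 12 6)"
      then have s: "same_from 5 (r, m) (r', m)" and "p = n"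
        using s1 e1 p pos[OF s1] by (auto simp: same_from_def)
      have "tup (r'(11 := 1)) = tup r'" by (auto simp: slots_def)
      then show "wp l (Const 11 1) (\<lambda>(r', m'). tup r' = ys \<and> inv p (insert ys A) (r', m')) (r', m)"
        using pos[OF s] yes \<open>p = n\<close> by (intro wp_Const) (auto simp: inv_def table_def)
    next
      fix r' assume "same_from 5 (r1, m) (r', m)" and "holds (r1, m) (Lt 12 6)"
      then have s: "same_from 5 (r, m) (r', m)" and "p < n"
        using s1 e1 p pos[OF s1] by (auto simp: same_from_def)
      let ?M = "table p A \<union> {(Suc (r' 12), upd i (r' 12) (tup r')) |i.
           i \<in> set [0..<k] \<and> chk i (r' 12) (tup r')}"
      have "?M = table p (insert ys A)"
        using yes \<open>p < n\<close> pos[OF s] succs_insert[of p ys "A \<inter> reach p"]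
        by (auto simp: table_def succs_def)
      moreover have "wp l (seqs (map (mark_prog k t) [0..<k]))
          (\<lambda>s. env s \<and> (\<forall>x\<ge>5. fst s x = r' x) \<and> marked ?M s) (r', m)"
        by (rule wp_seqs_mark_prog) (use pos[OF s] ys \<open>p < n\<close> in auto)
      ultimately have w: "wp l (seqs (map (mark_prog k t) [0..<k]))
          (\<lambda>s. env s \<and> (\<forall>x\<ge>5. fst s x = r' x) \<and> marked (table p (insert ys A)) s) (r', m)"
        by simp
      show "wp l (seqs (map (mark_prog k t) [0..<k]))
          (\<lambda>(r', m'). tup r' = ys \<and> inv p (insert ys A) (r', m')) (r', m)"
        apply (rule wp_mono[OF w])
        using pos[OF s] inv' \<open>p < n\<close> by (auto simp: inv_def slots_def)
    qed
  qed
qed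

lemma wp_main_prog:
  assumes "env (r, m)" "\<forall>a\<ge>B. m a = 0" "r 11 = 0"
  shows "wp l (main_prog k t) (\<lambda>s. fst s 11 = of_bool (reach n \<noteq> {})) (r, m)"
proof -
  let ?J = "\<lambda>p s. env s \<and> marked (table p {}) s \<and> fst s 11 = of_bool (p > n \<and> reach n \<noteq> {})"
  \<comment> \<open>All of \<open>reach p\<close> lies among the enumerated tuples, so after a full
    pass the partial row has become the complete row \<open>p + 1\<close>, and the row after it is
    still empty.\<close>
  have table_all: "table p (tuples dim n) = table (Suc p) {}" if "p \<le> n" for p
  proof -
    have "tuples dim n \<inter> reach p = reach p" using reach_subset[of p] by blast
    moreover have "succs p (reach p) = reach (Suc p)" "succs (Suc p) {} = {}"
      by (simp_all add: succs_def)
    ultimately show ?thesis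
      using that by (auto simp: table_def le_Suc_eq simp del: reach.simps)
  qed
  have nest: "wp l (Nest_prog (slots k t) (body_prog k t)) (inv p (tuples (length (slots k t)) n)) (r, m)"
    if "inv p {} (r, m)" "p \<le> n" for p r m
  proof (rule wp_Nest_prog)
    show "distinct (slots k t)" "\<forall>x\<in>set (slots k t). 11 \<le> x" "Suc n \<le> l"
      using n_less_l by (auto simp: slots_def)
    show "r 5 = 1 \<and> r 7 = Suc n" if "inv p A (r, m)" for A r m
      using that by (auto simp: inv_def env_def)
    show "inv p A (r(x := v), m)" if "inv p A (r, m)" "x \<in> insert 1 (set (slots k t))" for A r m x v
    proof -
      have "x \<notin> {5, 6, 7, 8, 9, 10, 14} \<and> x \<noteq> 11 \<and> x \<noteq> 12 \<and> x \<noteq> 13"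
        using that(2) by (auto simp: slots_def)
      then show ?thesis using that(1) by (simp add: inv_def)
    qed
    show "wp l (body_prog k t) (\<lambda>(r', m'). tup r' = tup r \<and> inv p (insert (tup r) A) (r', m')) (r, m)"
      if "inv p A (r, m)" "tup r \<in> tuples (length (slots k t)) n" for A r m
      by (rule wp_body_prog) (use that \<open>p \<le> n\<close> in \<open>auto simp: slots_def dim_def\<close>)
  qed (rule that)
  have len: "length (slots k t) = dim" by (simp add: slots_def dim_def)
  have "wp l (main_prog k t) (?J (Suc n)) (r, m)"
    unfolding main_prog_def
  proof (rule wp_For_prog[where J = ?J])
    show "Suc n \<le> l" using n_less_l by simp
    show "r 5 = 1 \<and> r 7 = Suc n" if "?J i (r, m)" for i r m
      using that by (auto simp: env_def)
    \<comment> \<open>Free memory is zero from \<open>B\<close> on, which represents the empty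
      table.\<close>
    show "?J 0 (r(12 := 0, 1 := v), m)" for v
      using assms by (auto simp: marked_def table_def succs_def addr_def)
    show "wp l (Seq (Add 13 12 5) (Nest_prog (slots k t) (body_prog k t)))
        (\<lambda>(r', m'). r' 12 = i \<and> (\<forall>v. ?J (Suc i) (r'(12 := Suc i, 1 := v), m'))) (r, m)"
      if "i < Suc n" "?J i (r, m)" "r 12 = i" for i r m
      apply (intro wp_Seq wp_Add)
      apply (rule wp_mono[OF nest[of i]])
      subgoal using that by (auto simp: inv_def env_def)
      subgoal using that by simp
      subgoal for r' m'
        using that reach_subset[of n] table_all[of i]
        by (auto simp: inv_def len Int_absorb1)
      done
  qed simp
  then show ?thesis by (rule wp_mono) simp
qed

end


section \<open>Tuples of a colouring\<close>

context dp
begin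

definition window :: "(nat \<Rightarrow> nat) \<Rightarrow> nat \<Rightarrow> nat \<Rightarrow> nat list" where
  "window d i p = take t (rev (filter (\<lambda>q. d q = i) [0..<p]) @ replicate t n)"

text \<open>A snapshot taken before \<open>p\<close> is coloured. The guess \<open>S\<close> never
  changes along a run and the windows depend on \<open>d\<close> below \<open>p\<close> only, so a
  run amounts to a pair of \<open>d\<close> and \<open>S\<close>.\<close>

definition conf :: "(nat \<Rightarrow> nat) \<Rightarrow> (nat \<Rightarrow> nat \<Rightarrow> nat) \<Rightarrow> nat \<Rightarrow> nat list" where
  "conf d S p = map (\<lambda>x. let i = x div (3 * t); j = x mod (3 * t) in
     if j < 2 * t then S i j else window d i p ! (j - 2 * t)) [0..<dim]"

definition valid :: "(nat \<Rightarrow> nat) \<Rightarrow> (nat \<Rightarrow> nat \<Rightarrow> nat) \<Rightarrow> nat \<Rightarrow> bool" where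
  "valid d S p \<longleftrightarrow> (\<forall>i<k. \<forall>j<2*t. S i j \<le> n) \<and> (\<forall>q<p. d q < k \<and> chk (d q) q (conf d S q))"

lemma length_window [simp]: "length (window d i p) = t"
  by (simp add: window_def)

lemma length_conf [simp]: "length (conf d S p) = dim"
  by (simp add: conf_def)

lemma window_Suc:
  "window d i (Suc p) = (if d p = i then take t (p # window d i p) else window d i p)"
proof -
  \<comment> \<open>Truncating to t vertices before pushing \<open>p\<close> loses nothing, so a
    window is updated without the full history.\<close>
  have "take t (p # take t ys) = take t (p # ys)" for ys :: "nat list"
    by (cases t) (simp_all add: min_def)
  then show ?thesis by (simp add: window_def del: take_append)
qed

lemma set_window: "set (window d i p) \<subseteq> {q. q < p \<and> d q = i} \<union> {n}"
  unfolding window_def by (rule subset_trans[OF set_take_subset]) auto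

lemma window_cong: "(\<And>q. q < p \<Longrightarrow> d q = d' q) \<Longrightarrow> window d i p = window d' i p"
proof -
  assume "\<And>q. q < p \<Longrightarrow> d q = d' q"
  then have "filter (\<lambda>q. d q = i) [0..<p] = filter (\<lambda>q. d' q = i) [0..<p]"
    by (intro filter_cong) auto
  then show ?thesis by (simp add: window_def)
qed

lemma conf_cong: "(\<And>q. q < p \<Longrightarrow> d q = d' q) \<Longrightarrow> conf d S p = conf d' S p"
  using window_cong[of p d d'] unfolding conf_def by presburger

lemma entry_conf:
  assumes "i < k" "j < 3 * t"
  shows "entry (conf d S p) i j = (if j < 2 * t then S i j else window d i p ! (j - 2 * t))"
proof -
  have "(3 * t * i + j) div (3 * t) = i" "(3 * t * i + j) mod (3 * t) = j"
    using assms by auto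
  then show ?thesis
    using slot_less_dim[OF assms] by (simp add: entry_def conf_def)
qed

lemma less_dimE:
  assumes "x < dim"
  obtains i j where "i < k" "j < 3 * t" "x = 3 * t * i + j"
proof
  have "3 * t > 0" using assms unfolding dim_def by (cases "t = 0") simp_all
  then show "x mod (3 * t) < 3 * t" by simp
  show "x div (3 * t) < k" using assms by (simp add: dim_def less_mult_imp_div_less mult.commute)
  show "x = 3 * t * (x div (3 * t)) + x mod (3 * t)" by simp
qed

lemma entry_eqI:
  assumes "length ys = dim" "length zs = dim"
    and "\<And>i j. i < k \<Longrightarrow> j < 3 * t \<Longrightarrow> entry ys i j = entry zs i j"
  shows "ys = zs"
proof (rule nth_equalityI)
  fix x assume "x < length ys"
  then obtain i j where "i < k" "j < 3 * t" "x = 3 * t * i + j"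
    using assms(1) less_dimE by metis
  then show "ys ! x = zs ! x" using assms(3) by (simp add: entry_def)
qed (simp add: assms)

lemma tuples_entryI:
  assumes "length ys = dim" "\<And>i j. i < k \<Longrightarrow> j < 3 * t \<Longrightarrow> entry ys i j \<le> n"
  shows "ys \<in> tuples dim n"
proof -
  have "ys ! x \<le> n" if "x < dim" for x
    using that assms(2) by (elim less_dimE) (simp add: entry_def)
  then show ?thesis using assms(1) by (auto simp: tuples_def in_set_conv_nth)
qed

lemma entry_upd:
  assumes "i < k" "j < 3 * t" "c < k"
  shows "entry (upd c p ys) i j = (if i = c \<and> j = 2 * t then p
     else if i = c \<and> 2 * t < j then entry ys i (j - 1) else entry ys i j)"
proof -
  have div: "(3 * t * i + j) div (3 * t) = i" using assms by auto
  have c: "i = c \<and> j \<ge> 2 * t"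
    if "3 * t * c + 2 * t \<le> 3 * t * i + j" "3 * t * i + j < 3 * t * c + 3 * t"
  proof -
    have "(3 * t * i + j) div (3 * t) = c"
      using that by (intro div_nat_eqI) (auto simp: algebra_simps)
    then show ?thesis using div that by auto
  qed
  show ?thesis
    using slot_less_dim[OF assms(1,2)] c assms by (auto simp: entry_def upd_def)
qed

lemma upd_conf:
  assumes "d p < k"
  shows "upd (d p) p (conf d S p) = conf d S (Suc p)"
proof (rule entry_eqI)
  show "length (upd (d p) p (conf d S p)) = dim" by (simp add: upd_def)
  show "entry (upd (d p) p (conf d S p)) i j = entry (conf d S (Suc p)) i j"
    if "i < k" "j < 3 * t" for i j
    using that assms
    by (auto simp: entry_upd entry_conf window_Suc nth_Cons' not_less add.commute)
qed simp

lemma conf_0_in_start: "(\<forall>i<k. \<forall>j<2*t. S i j \<le> n) \<Longrightarrow> conf d S 0 \<in> start"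
  by (auto simp: start_def entry_conf window_def intro!: tuples_entryI)

lemma in_startE:
  assumes "ys \<in> start"
  obtains S where "\<forall>i<k. \<forall>j<2*t. S i j \<le> n" "ys = conf d S 0"
proof
  have t: "ys \<in> tuples dim n" using assms by (simp add: start_def)
  show "\<forall>i<k. \<forall>j<2*t. entry ys i j \<le> n"
  proof (intro allI impI)
    fix i j assume "i < k" "j < 2 * t"
    then have "ys ! (3 * t * i + j) \<in> set ys"
      using t slot_less_dim[of i j] by (intro nth_mem) (auto simp: tuples_def)
    then show "entry ys i j \<le> n" using t by (auto simp: entry_def tuples_def)
  qed
  show "ys = conf d (entry ys) 0"
  proof (rule entry_eqI)
    fix i j assume ij: "i < k" "j < 3 * t"
    have "entry ys i j = n" if "\<not> j < 2 * t"
    proof -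
      from that obtain j' where "j = 2 * t + j'" by (metis le_add_diff_inverse not_less)
      then show ?thesis using ij assms by (auto simp: start_def)
    qed
    then show "entry ys i j = entry (conf d (entry ys) 0) i j"
      using ij by (auto simp: entry_conf window_def)
  qed (use t in \<open>auto simp: tuples_def\<close>)
qed

text \<open>The colouring is restored one value at a time. Changing \<open>d\<close> at
  \<open>p\<close> affects no snapshot up to \<open>p\<close>, so the checks already passed remain
  valid.\<close>

lemma reach_iff:
  assumes "p \<le> n"
  shows "ys \<in> reach p \<longleftrightarrow> (\<exists>d S. valid d S p \<and> ys = conf d S p)"
  using assms
proof (induction p arbitrary: ys)
  case 0
  show ?case
    using conf_0_in_start in_startE[of ys] by (simp add: valid_def) metis
next
  case (Suc p)
  show ?case
  proof
    assume "ys \<in> reach (Suc p)"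
    then obtain i zs where i: "i < k" "zs \<in> reach p" "chk i p zs" "ys = upd i p zs"
      by (auto simp: succs_def)
    then obtain d S where d: "valid d S p" "zs = conf d S p" using Suc by auto
    let ?d = "d(p := i)"
    have eq: "conf ?d S q = conf d S q" if "q \<le> p" for q
      using that by (intro conf_cong) auto
    have "valid ?d S (Suc p)"
      using d i eq by (auto simp: valid_def less_Suc_eq)
    moreover have "ys = conf ?d S (Suc p)"
      using upd_conf[of ?d p S] i d eq[of p] by simp
    ultimately show "\<exists>d S. valid d S (Suc p) \<and> ys = conf d S (Suc p)" by blast
  next
    assume "\<exists>d S. valid d S (Suc p) \<and> ys = conf d S (Suc p)"
    then obtain d S where d: "valid d S (Suc p)" "ys = conf d S (Suc p)" by blast
    then have "valid d S p" "d p < k" "chk (d p) p (conf d S p)" by (auto simp: valid_def)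
    moreover from this have "conf d S p \<in> reach p" using Suc by auto
    ultimately have "upd (d p) p (conf d S p) \<in> succs p (reach p)"
      unfolding succs_def using Suc.prems by auto
    then show "ys \<in> reach (Suc p)" using d \<open>d p < k\<close> upd_conf[of d p S] by simp
  qed
qed

section \<open>Soundness: without the pattern, accepted colourings are proper\<close>

lemma chk_nonadj: "chk i p ys \<Longrightarrow> j < 3 * t \<Longrightarrow> \<not> nb p (entry ys i j)"
  by (simp add: chk_def)

lemma nonadj_window:
  assumes "valid d S n" "v < n" "x \<in> set (window d (d v) v)"
  shows "\<not> nb v x"
proof -
  obtain j where j: "j < t" "x = window d (d v) v ! j"
    using assms(3) by (auto simp: in_set_conv_nth)
  moreover have "chk (d v) v (conf d S v)" "d v < k" using assms by (auto simp: valid_def)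
  ultimately show ?thesis
    using entry_conf[of "d v" "2 * t + j" d S v] chk_nonadj[of "d v" v _ "2 * t + j"] by force
qed

lemma nonadj_guess:
  assumes "valid d S n" "v < n" "j < 2 * t"
  shows "\<not> nb v (S (d v) j)"
proof -
  have "chk (d v) v (conf d S v)" "d v < k" using assms by (auto simp: valid_def)
  then show ?thesis using assms(3) entry_conf[of "d v" j d S v] chk_nonadj[of "d v" v _ j] by force
qed

lemma guess_chain:
  assumes "valid d S n" "v < n" and new: "\<forall>j<2*t. v \<noteq> S (d v) j"
  shows "\<forall>j<t. S (d v) j < v" "\<forall>j<t. v < S (d v) (t + j)"
    "\<forall>j<2*t. S (d v) j < n" "\<forall>j<2*t. \<forall>j'<j. S (d v) j' < S (d v) j"
    "\<forall>j<2*t. \<forall>j'<j. \<not> nb (S (d v) j') (S (d v) j)"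
proof -
  have chk: "chk (d v) v (conf d S v)" "d v < k" using assms by (auto simp: valid_def)
  have e: "entry (conf d S v) (d v) j = S (d v) j" if "j < 2 * t" for j
    using that chk(2) by (simp add: entry_conf)
  have "(\<forall>j<t. S (d v) j < v) \<and> (\<forall>j<t. v < S (d v) (t + j)) \<and>
      (\<forall>j<2*t. S (d v) j < n \<and> (\<forall>j'<j. S (d v) j' < S (d v) j \<and> \<not> nb (S (d v) j') (S (d v) j)))"
    using chk(1) new by (simp add: chk_def e cong: conj_cong)
  then show "\<forall>j<t. S (d v) j < v" "\<forall>j<t. v < S (d v) (t + j)"
    "\<forall>j<2*t. S (d v) j < n" "\<forall>j<2*t. \<forall>j'<j. S (d v) j' < S (d v) j"
    "\<forall>j<2*t. \<forall>j'<j. \<not> nb (S (d v) j') (S (d v) j)" by auto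
qed

definition one_edge_pattern :: "nat \<Rightarrow> nat \<Rightarrow> bool" where
  "one_edge_pattern a b \<longleftrightarrow> (\<exists>g :: nat \<Rightarrow> nat. (\<forall>x<t. g x < n) \<and>
     (\<forall>y<t. \<forall>x<y. g x < g y \<and> (adj (g x) (g y) \<longleftrightarrow> x = a \<and> y = b)))"

text \<open>
  If u and v form the monochromatic edge with the smallest right end, then the
  first t vertices of the colour, u, the last t vertices of the colour before v, v, and the last
  t vertices of the colour contain this pattern.
\<close>

lemma valid_imp_proper:
  assumes valid: "valid d S n"
    and sym: "\<And>x y. adj x y \<Longrightarrow> adj y x"
    and ab: "a < b" "b < t"
    and free: "\<not> one_edge_pattern a b"
    and "u < v" "v < n" "d u = d v"
  shows "\<not> adj u v"
proof
  let ?bad = "\<lambda>v. v < n \<and> (\<exists>u<v. d u = d v \<and> adj u v)"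
  assume "adj u v"
  then have "?bad v" using assms by auto
  define w where "w = (LEAST v. ?bad v)"
  have w: "?bad w" unfolding w_def using \<open>?bad v\<close> by (rule LeastI)
  have least: "\<not> adj x y" if "x < y" "y < w" "d x = d y" for x y
    using that w not_less_Least[of y ?bad] by (auto simp: w_def)
  obtain z where z: "z < w" "d z = d w" "adj z w" using w by blast
  define s where "s = S (d w)"
  define L where "L = filter (\<lambda>q. d q = d w) [0..<w]"
  have sortedL: "sorted_wrt (<) L" unfolding L_def by (intro sorted_wrt_filter) simp
  have zL: "z \<in> set L" using z by (simp add: L_def)
  have nb_zw: "nb w z" using z w sym by (auto simp: nb_def)
  have z_win: "z \<notin> set (window d (d w) w)" using nonadj_window[OF valid, of w] nb_zw w by blast
  \<comment> \<open>A window that covers all earlier vertices of the colour would contain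
    \<open>z\<close>; hence more than t of them precede \<open>w\<close>.\<close>
  have len: "t < length L"
  proof (rule ccontr)
    assume "\<not> t < length L"
    then have "set L \<subseteq> set (window d (d w) w)" by (auto simp: window_def L_def[symmetric])
    then show False using zL z_win by blast
  qed
  define W where "W = drop (length L - t) L"
  have win: "window d (d w) w = rev W"
    using len by (simp add: window_def W_def L_def[symmetric] take_rev)
  have lenW: "length W = t" using len by (simp add: W_def)
  have L_split: "L = take (length L - t) L @ W" by (simp add: W_def)
  then have L_set: "set L = set (take (length L - t) L) \<union> set W" by (metis set_append)
  have W_set: "x < w" "d x = d w" if "x \<in> set W" for x
    using that L_set by (auto simp: L_def)
  have sorted: "sorted_wrt (<) (take (length L - t) L @ W)" using sortedL L_split by simp
  have "z \<in> set (take (length L - t) L)" using zL L_set z_win win by auto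
  then have zW: "z < x" if "x \<in> set W" for x using sorted that by (auto simp: sorted_wrt_append)
  have W_mono: "W ! x < W ! y" if "x < y" "y < t" for x y
    using sorted that lenW by (auto simp: sorted_wrt_append intro: sorted_wrt_nth_less)
  have W_mem: "W ! x \<in> set W" if "x < t" for x using that lenW by simp
  have adj_s: "\<not> adj x (s j)" "\<not> adj (s j) x" if "x < n" "d x = d w" "j < 2 * t" "s j < n" for x j
    using nonadj_guess[OF valid that(1,3)] that sym by (auto simp: nb_def s_def)
  \<comment> \<open>If \<open>w\<close> were guessed, the check of \<open>z\<close> against the
    guess would have seen the edge; the same holds with the roles exchanged. So
    \<open>guess_chain\<close> applies to both ends.\<close>
  have "w \<noteq> s j" if "j < 2 * t" for j
    using nonadj_guess[OF valid _ that, of z] z w that by (auto simp: nb_def s_def)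
  then have new_w: "\<forall>j<2*t. w \<noteq> S (d w) j" by (simp add: s_def)
  have "z \<noteq> s j" if "j < 2 * t" for j
    using nonadj_guess[OF valid _ that, of w] z w that nb_zw by (auto simp: s_def)
  then have new_z: "\<forall>j<2*t. z \<noteq> S (d z) j" using z by (simp add: s_def)
  \<comment> \<open>Both ends have the same colour and hence the same guess: its first half lies
    before \<open>z\<close>, its second half after \<open>w\<close>.\<close>
  note cw = guess_chain[OF valid conjunct1[OF w] new_w, folded s_def]
  have "z < n" using z w by auto
  note cz = guess_chain[OF valid \<open>z < n\<close> new_z, unfolded \<open>d z = d w\<close>, folded s_def]
  \<comment> \<open>Each reservoir has t elements, so position \<open>x\<close> can take the element
    with index \<open>x\<close> in it without renumbering, and monotonicity inside a block is
    inherited.\<close>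
  define g where "g x = (if x < a then s x else if x = a then z else if x < b then W ! x
    else if x = b then w else s (t + x))" for x
  have "one_edge_pattern a b"
    unfolding one_edge_pattern_def
  proof (intro exI[of _ g] conjI allI impI)
    have s_less: "s x < z" "w < s (t + x)" "s x < n" "s (t + x) < n" if "x < t" for x
      using that cz(1) cw(2,3) by auto
    have W_less: "z < W ! x" "W ! x < w" "d (W ! x) = d w" if "x < t" for x
      using that W_mem zW W_set by auto
    have s_mono: "s x < s y" "\<not> adj (s x) (s y)" if "x < y" "y < 2 * t" for x y
      using that cw(3,4,5) by (auto simp: nb_def)
    show g_mono: "g x < g y" if "x < y" "y < t" for x y
    proof -
      have "g x < z" if "x < a" using that s_less[of x] ab by (simp add: g_def)
      moreover have "z < g y" if "a < y"
        using that \<open>y < t\<close> s_less[of y] W_less[of y] z by (auto simp: g_def)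
      moreover have "g x < w" if "x < b"
        using that ab s_less[of x] W_less[of x] z by (auto simp: g_def)
      moreover have "w < g y" if "b < y" using that \<open>y < t\<close> s_less[of y] ab by (simp add: g_def)
      moreover have "g a = z" "g b = w" using ab by (auto simp: g_def)
      moreover have "g x < g y" if "y < a" using that \<open>x < y\<close> ab s_mono[of x y] by (simp add: g_def)
      moreover have "g x < g y" if "b < x"
        using that \<open>x < y\<close> \<open>y < t\<close> ab s_mono[of "t + x" "t + y"] by (simp add: g_def)
      moreover have "g x < g y" if "a < x" "y < b"
        using that \<open>x < y\<close> \<open>y < t\<close> W_mono[of x y] by (simp add: g_def)
      ultimately show ?thesis using \<open>x < y\<close> ab
        by (cases x a rule: linorder_cases; cases y a rule: linorder_cases;
            cases x b rule: linorder_cases; cases y b rule: linorder_cases) auto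
    qed
    show g_less: "g x < n" if "x < t" for x
      using that s_less[of x] W_less[of x] w z by (auto simp: g_def)
    have col: "d (g x) = d w" if "a \<le> x" "x \<le> b" for x
      using that W_less[of x] ab z by (auto simp: g_def)
    have s_eq: "\<exists>j<2*t. g x = s j \<and> (x < a \<longrightarrow> j = x) \<and> (b < x \<longrightarrow> j = t + x)"
      if "x < a \<or> b < x" "x < t" for x
      using that ab by (auto simp: g_def)
    show "adj (g x) (g y) \<longleftrightarrow> x = a \<and> y = b" if xy: "x < y" "y < t" for x y
    proof (cases "x = a \<and> y = b")
      case True
      then show ?thesis using ab z by (auto simp: g_def)
    next
      case False
      \<comment> \<open>Between a and b, the window of \<open>w\<close> handles the pairs ending in
        b and minimality of \<open>w\<close> the others. A pair with one position outside joins a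
        vertex of the colour to a guess; a pair with both outside joins two guesses.\<close>
      have "\<not> adj (g x) (g y)"
      proof (cases "a \<le> x \<and> x \<le> b")
        case x: True
        show ?thesis
        proof (cases "y \<le> b")
          case True
          show ?thesis
          proof (cases "y = b")
            case True
            then have "g x \<in> set (window d (d w) w)" "g y = w"
              using x False \<open>x < y\<close> ab W_mem[of x] by (auto simp: g_def win)
            then show ?thesis
              using nonadj_window[OF valid, of w "g x"] w sym g_less[of x] that by (auto simp: nb_def)
          next
            case False
            then have "g y < w" using x True \<open>x < y\<close> W_less[of y] ab by (auto simp: g_def)
            then show ?thesis
              using least[of "g x" "g y"] g_mono[OF that] col[of x] col[of y] x True that by auto
          qed
        next
          case False
          then obtain j where "j < 2 * t" "g y = s j" using s_eq[of y] xy by (meson not_le)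
          then show ?thesis using adj_s(1)[of "g x" j] col x g_less that
            by (metis less_trans)
        qed
      next
        case x: False
        then obtain j where j: "j < 2 * t" "g x = s j" "x < a \<longrightarrow> j = x" "b < x \<longrightarrow> j = t + x"
          using s_eq[of x] xy by (meson not_le less_trans)
        show ?thesis
        proof (cases "a \<le> y \<and> y \<le> b")
          case True
          then show ?thesis using adj_s(2)[of "g y" j] col j g_less that
            by (metis less_trans)
        next
          case False
          then obtain j' where j': "j' < 2 * t" "g y = s j'" "y < a \<longrightarrow> j' = y" "b < y \<longrightarrow> j' = t + y"
            using s_eq[of y] xy by (meson not_le)
          have "j < j'" using j j' x False that by auto
          then show ?thesis using s_mono(2)[of j j'] j j' by simp
        qed
      qed
      then show ?thesis using False by simp
    qed
  qed
  then show False using free by contradiction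
qed

text \<open>Guess the truth: every entry of a snapshot is then \<open>n\<close> or a vertex of the
  colour in question, and properness gives all nonadjacencies. A vertex outside the guess has t
  guessed vertices of its class on each side.\<close>

lemma proper_imp_valid:
  assumes col: "\<And>v. v < n \<Longrightarrow> d v < k \<and> avail (d v) v"
    and proper: "\<And>u v. u < n \<Longrightarrow> v < n \<Longrightarrow> d u = d v \<Longrightarrow> \<not> adj u v"
  shows "\<exists>S. valid d S n"
proof -
  define cl where "cl i = filter (\<lambda>q. d q = i) [0..<n]" for i
  \<comment> \<open>Short classes are listed completely and padded with \<open>n\<close>. In a long
    class the indices t to 2t - 1 run through the last t elements, ending at the last one for
    \<open>j = 2t - 1\<close>.\<close>
  define S where "S i j = (let xs = cl i in
     if length xs \<le> 2 * t then (if j < length xs then xs ! j else n)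
     else if j < t then xs ! j else xs ! (length xs - 2 * t + j))" for i j
  have cl: "x < n" "d x = i" if "x \<in> set (cl i)" for x i
    using that by (auto simp: cl_def)
  have sorted: "cl i ! x < cl i ! y" if "x < y" "y < length (cl i)" for i x y
    using that sorted_wrt_filter[of "(<)" "[0..<n]" "\<lambda>q. d q = i"]
    by (auto simp: cl_def intro: sorted_wrt_nth_less)
  have S: "S i j \<in> insert n (set (cl i))" if "j < 2 * t" for i j
    using that by (auto simp: S_def Let_def intro!: nth_mem)
  have "valid d S n"
    unfolding valid_def
  proof (intro conjI allI impI)
    show "S i j \<le> n" if "i < k" "j < 2 * t" for i j
      using S[OF that(2), of i] cl(1)[of "S i j" i] by auto
    fix v assume v: "v < n"
    then show dv: "d v < k" using col by simp
    define i where "i = d v"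
    let ?e = "entry (conf d S v) i"
    have ent: "?e j \<in> {q. q < n \<and> d q = i} \<union> {n}" if "j < 3 * t" for j
    proof (cases "j < 2 * t")
      case True
      then show ?thesis
        using S[OF True, of i] cl[of "S i j" i] dv that by (auto simp: entry_conf i_def)
    next
      case False
      then have "?e j \<in> set (window d i v)"
        using that dv by (auto simp: entry_conf i_def)
      then show ?thesis using set_window[of d i v] v by auto
    qed
    \<comment> \<open>The entry may be \<open>x\<close> itself; \<open>proper\<close> with equal
      arguments then excludes a loop.\<close>
    have nb: "\<not> nb x (?e j)" if "d x = i" "j < 3 * t" for x j
      using ent[OF that(2)] that(1) proper[of x "?e j"] by (auto simp: nb_def)
    have e: "?e j = S i j" if "j < 2 * t" for j using that dv by (simp add: entry_conf i_def)
    have "(\<forall>j<t. ?e j < v) \<and> (\<forall>j<t. v < ?e (t + j)) \<and>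
      (\<forall>j<2*t. ?e j < n \<and> (\<forall>j'<j. ?e j' < ?e j \<and> \<not> nb (?e j') (?e j)))"
      if new: "\<not> (\<exists>j<2*t. v = ?e j)"
    proof -
      have new': "v \<noteq> S i j" if "j < 2 * t" for j using new e[OF that] that by auto
      have "v \<in> set (cl i)" using v by (simp add: cl_def i_def)
      then obtain x where x: "x < length (cl i)" "v = cl i ! x" by (auto simp: in_set_conv_nth)
      let ?l = "length (cl i)"
      \<comment> \<open>As \<open>v\<close> is not guessed, its class has more than 2t members and
        its position \<open>x\<close> avoids the first t and the last t places.\<close>
      have big: "2 * t < ?l"
      proof (rule ccontr)
        assume "\<not> 2 * t < ?l"
        then have "x < 2 * t" "S i x = v" using x by (auto simp: S_def Let_def)
        then show False using new' by blast
      qed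
      have xt: "t \<le> x"
      proof (rule ccontr)
        assume "\<not> t \<le> x"
        then have "x < 2 * t" "S i x = v" using x big by (auto simp: S_def Let_def)
        then show False using new' by blast
      qed
      have xl: "x < ?l - t"
      proof (rule ccontr)
        assume "\<not> x < ?l - t"
        then have "x - (?l - 2 * t) < 2 * t" "\<not> x - (?l - 2 * t) < t"
          "?l - 2 * t + (x - (?l - 2 * t)) = x"
          using x big by auto
        moreover from this have "S i (x - (?l - 2 * t)) = v"
          using x big by (auto simp: S_def Let_def)
        ultimately show False using new' by blast
      qed
      have lt: "S i j < n" if "j < 2 * t" for j
        using that big cl(1)[of _ i] by (auto simp: S_def Let_def)
      have "\<forall>j<t. S i j < v"
        using big xt x sorted[of _ x i] by (auto simp: S_def Let_def)
      moreover have "\<forall>j<t. v < S i (t + j)"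
        using big xl x sorted[of x _ i] by (auto simp: S_def Let_def)
      moreover have "S i j' < S i j" if "j < 2 * t" "j' < j" for j j'
        using that big by (auto simp: S_def Let_def intro!: sorted)
      moreover have "\<not> nb (S i j') (S i j)" if "j < 2 * t" "j' < j" for j j'
      proof -
        have "S i j' \<in> set (cl i)" using S[of j' i] lt[of j'] that by auto
        then show ?thesis using nb[of "S i j'" j] e[of j] cl(2)[of "S i j'" i] that by auto
      qed
      ultimately show ?thesis using e lt by simp
    qed
    moreover have "avail i v" using col v by (simp add: i_def)
    moreover have "\<forall>j<3*t. \<not> nb v (?e j)" using nb by (simp add: i_def)
    ultimately show "chk (d v) v (conf d S v)" unfolding chk_def i_def by blast
  qed
  then show ?thesis by blast
qed

lemma reach_iff_colorable:
  assumes sym: "\<And>x y. adj x y \<Longrightarrow> adj y x" and irrefl: "\<And>x. \<not> adj x x"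
    and ab: "a < b" "b < t"
    and free: "\<not> one_edge_pattern a b"
  shows "reach n \<noteq> {} \<longleftrightarrow> (\<exists>d. (\<forall>v<n. d v < k \<and> avail (d v) v) \<and>
     (\<forall>u<n. \<forall>v<n. adj u v \<longrightarrow> d u \<noteq> d v))"
proof
  assume "reach n \<noteq> {}"
  then obtain d S where valid: "valid d S n" using reach_iff[of n] by auto
  have proper: "\<not> adj u v" if "u < v" "v < n" "d u = d v" for u v
    by (rule valid_imp_proper[OF valid _ ab free that]) (rule sym)
  have "d u \<noteq> d v" if "u < n" "v < n" "adj u v" for u v
  proof
    assume eq: "d u = d v"
    have "u \<noteq> v" using that irrefl by auto
    then show False
      using proper[of u v] proper[of v u] that eq sym by (cases u v rule: linorder_cases) auto
  qed
  moreover have "d v < k \<and> avail (d v) v" if "v < n" for v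
    using valid that by (auto simp: valid_def chk_def)
  ultimately show "\<exists>d. (\<forall>v<n. d v < k \<and> avail (d v) v) \<and>
     (\<forall>u<n. \<forall>v<n. adj u v \<longrightarrow> d u \<noteq> d v)" by blast
next
  assume "\<exists>d. (\<forall>v<n. d v < k \<and> avail (d v) v) \<and> (\<forall>u<n. \<forall>v<n. adj u v \<longrightarrow> d u \<noteq> d v)"
  then obtain d where "\<forall>v<n. d v < k \<and> avail (d v) v" "\<forall>u<n. \<forall>v<n. adj u v \<longrightarrow> d u \<noteq> d v"
    by blast
  then obtain S where "valid d S n" using proper_imp_valid[of d] by blast
  then show "reach n \<noteq> {}" using reach_iff[of n] by blast
qed

end


section \<open>Reading the input\<close>

context ram
begin

lemma wp_init_prog:
  assumes w: "length w = B" "\<forall>i<n. w ! i" "\<not> w ! n"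
    and adj: "\<forall>u<n. \<forall>v<n. w ! (Suc n + (u * n + v)) \<longleftrightarrow> adj u v"
    and avail: "\<forall>v<n. \<forall>i<k. w ! (n * n + n + 1 + (v * k + i)) \<longleftrightarrow> avail i v"
  shows "wp l (init_prog k) (\<lambda>s. env s \<and> (\<forall>a\<ge>B. snd s a = 0) \<and> fst s 11 = 0) (initial_state w)"
proof -
  define m where "m a = (if a < B then of_bool (w ! a) else 0 :: nat)" for a
  define r0 :: "reg \<Rightarrow> nat" where "r0 x = (if x = 0 then B else 0)" for x
  define r where "r = r0(5 := 1, 8 := B)"
  have loop: "wp l (WhileNZ 2 (Seq (Add 6 6 5) (Load 2 6)))
      (\<lambda>s. snd s = m \<and> fst s 6 = n \<and> (\<forall>x. x \<notin> {2, 6} \<longrightarrow> fst s x = r x)) (r(2 := m 0), m)"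
  proof (rule wp_WhileNZ[where c = n and I = "\<lambda>i s. snd s = m \<and> fst s 6 = i \<and> fst s 2 = m i \<and>
      (\<forall>x. x \<notin> {2, 6} \<longrightarrow> fst s x = r x)"])
    have "m i = 1" if "i < n" for i using that w B by (simp add: m_def)
    moreover have "m n = 0" using w by (simp add: m_def)
    ultimately show "r' 2 \<noteq> 0 \<and> wp l (Seq (Add 6 6 5) (Load 2 6)) (\<lambda>s. snd s = m \<and> fst s 6 = Suc i \<and>
        fst s 2 = m (Suc i) \<and> (\<forall>x. x \<notin> {2, 6} \<longrightarrow> fst s x = r x)) (r', m')"
      if "i < n" "snd (r', m') = m \<and> fst (r', m') 6 = i \<and> fst (r', m') 2 = m i \<and>
        (\<forall>x. x \<notin> {2, 6} \<longrightarrow> fst (r', m') x = r x)" for i r' m'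
      using that by (auto simp: r_def r0_def simp flip: Suc_eq_plus1)
  qed (use n_less_l w in \<open>auto simp: r_def r0_def m_def\<close>)
  have fin: "wp l (seqs [Add 7 6 5, Const 9 k, Const 1 0, horner_prog 6 [6, 7], Add 10 10 1])
      (\<lambda>s. env s \<and> (\<forall>a\<ge>B. snd s a = 0) \<and> fst s 11 = 0) (r', m)"
    if "r' 6 = n" "\<forall>x. x \<notin> {2, 6} \<longrightarrow> r' x = r x" for r'
  proof -
    let ?r = "r'(7 := Suc n, 9 := k, 1 := 0)"
    have h: "wp l (horner_prog 6 [6, 7])
        (\<lambda>s. same_from 5 (?r, m) s \<and> fst s 1 = horner (?r 6) (?r 1) (map ?r [6, 7])) (?r, m)"
      by (rule wp_horner_prog) (use that n_less_l in \<open>auto simp: r_def r0_def\<close>)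
    have "m (Suc n + (u * n + v)) \<noteq> 0 \<longleftrightarrow> adj u v" if "u < n" "v < n" for u v
      using that adj adj_addr_less[OF that] by (simp add: m_def)
    moreover have "m (n * n + n + 1 + (v * k + i)) \<noteq> 0 \<longleftrightarrow> avail i v" if "v < n" "i < k" for v i
      using that avail avail_addr_less[OF that] by (simp add: m_def)
    moreover have "\<forall>a\<ge>B. m a = 0" by (simp add: m_def)
    ultimately have m: "(\<forall>u<n. \<forall>v<n. m (Suc n + (u * n + v)) \<noteq> 0 \<longleftrightarrow> adj u v) \<and>
      (\<forall>v<n. \<forall>i<k. m (n * n + n + 1 + (v * k + i)) \<noteq> 0 \<longleftrightarrow> avail i v) \<and> (\<forall>a\<ge>B. m a = 0)"
      by blast
    have eq: "r'(7 := r' 6 + r' 5, 9 := k, 1 := 0) = ?r"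
      using that by (auto simp: r_def r0_def)
    show ?thesis
      unfolding seqs_def foldr.simps o_def id_apply
    proof (intro wp_Seq wp_Add wp_Const, unfold eq, intro wp_mono[OF h] wp_Seq wp_Add wp_Skip)
      fix r2 m2
      assume a: "same_from 5 (?r, m) (r2, m2) \<and>
        fst (r2, m2) 1 = horner (?r 6) (?r 1) (map ?r [6, 7])"
      then have "m2 = m" "\<forall>x\<ge>5. r2 x = ?r x" "r2 1 = n * n + n + 1"
        using that by (auto simp: same_from_def)
      then show "env (r2(10 := r2 10 + r2 1), m2) \<and> (\<forall>a\<ge>B. snd (r2(10 := r2 10 + r2 1), m2) a = 0) \<and>
          fst (r2(10 := r2 10 + r2 1), m2) 11 = 0"
        using m that by (simp add: env_def r_def r0_def)
    qed
  qed
  have init: "initial_state w = (r0, m)"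
    using w by (auto simp: initial_state_def m_def r0_def)
  have state: "r0(5 := 1, 8 := (r0(5 := 1)) 8 + (r0(5 := 1)) 0) = r"
    by (simp add: r_def r0_def)
  have r6: "r 6 = 0" by (simp add: r_def r0_def)
  have "wp l (Seq (Const 5 1) (Seq (Add 8 8 0) (Seq (Load 2 6)
      (Seq (WhileNZ 2 (Seq (Add 6 6 5) (Load 2 6)))
        (seqs [Add 7 6 5, Const 9 k, Const 1 0, horner_prog 6 [6, 7], Add 10 10 1])))))
      (\<lambda>s. env s \<and> (\<forall>a\<ge>B. snd s a = 0) \<and> fst s 11 = 0) (initial_state w)"
    unfolding init
    apply (intro wp_Seq wp_Const wp_Add wp_Load)
    unfolding state r6
    apply (rule wp_mono[OF loop])
    using fin by simp
  then show ?thesis by (simp add: init_prog_def seqs_def)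
qed

lemma wp_coloring_prog:
  assumes "length w = B" "\<forall>i<n. w ! i" "\<not> w ! n"
    and "\<forall>u<n. \<forall>v<n. w ! (Suc n + (u * n + v)) \<longleftrightarrow> adj u v"
    and "\<forall>v<n. \<forall>i<k. w ! (n * n + n + 1 + (v * k + i)) \<longleftrightarrow> avail i v"
  shows "wp l (coloring_prog k t) (\<lambda>s. fst s 0 = of_bool (reach n \<noteq> {})) (initial_state w)"
  unfolding coloring_prog_def
proof (intro wp_Seq wp_mono[OF wp_init_prog[OF assms]])
  fix r m
  assume "env (r, m) \<and> (\<forall>a\<ge>B. snd (r, m) a = 0) \<and> fst (r, m) 11 = 0"
  then have "wp l (main_prog k t) (\<lambda>s. fst s 11 = of_bool (reach n \<noteq> {})) (r, m)"
    by (intro wp_main_prog) auto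
  then show "wp l (main_prog k t)
      (wp l (Seq (Const 0 0) (Add 0 0 11)) (\<lambda>s. fst s 0 = of_bool (reach n \<noteq> {}))) (r, m)"
    by (rule wp_mono) auto
qed

end

section \<open>Bit positions in the encoding\<close>

lemma length_concat_map_uniform:
  "\<forall>x\<in>set xs. length (f x) = c \<Longrightarrow> length (concat (map f xs)) = length xs * c"
  by (induction xs) auto

lemma nth_concat_map_uniform:
  assumes "\<forall>x\<in>set xs. length (f x) = c" "i < length xs" "j < c"
  shows "concat (map f xs) ! (i * c + j) = f (xs ! i) ! j"
  using assms
proof (induction xs arbitrary: i)
  case (Cons x xs)
  then show ?case by (cases i) (auto simp: nth_append)
qed simp

text \<open>The unary part ends with its zero bit at position n, so the matrix starts at n + 1 and
  the lists at n * n + n + 1. Colour \<open>i\<close> of the dynamic program is colour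
  \<open>Suc i\<close> of the instance.\<close>

lemma encode_instance_nth:
  fixes G :: "'a ograph" and L :: "'a \<Rightarrow> nat set" and k :: nat
  defines "vs \<equiv> vertex_list G"
  defines "n \<equiv> length vs" and "w \<equiv> encode_instance k (G, L)"
  shows "length w = n * n + n + 1 + n * k"
    and "\<forall>i<n. w ! i" and "\<not> w ! n"
    and "\<forall>u<n. \<forall>v<n. w ! (Suc n + (u * n + v)) \<longleftrightarrow> {vs ! u, vs ! v} \<in> edges G"
    and "\<forall>v<n. \<forall>i<k. w ! (n * n + n + 1 + (v * k + i)) \<longleftrightarrow> Suc i \<in> L (vs ! v)"
proof -
  define A where "A = concat (map (\<lambda>u. map (\<lambda>v. {u, v} \<in> edges G) vs) vs)"
  define C where "C = concat (map (\<lambda>v. map (\<lambda>i. i \<in> L v) [1..<Suc k]) vs)"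
  have w: "w = replicate n True @ False # A @ C"
    by (simp add: w_def encode_instance_def n_def vs_def A_def C_def Let_def)
  have lenA: "length A = n * n"
    unfolding A_def n_def by (rule length_concat_map_uniform) simp
  have lenC: "length C = n * k"
    unfolding C_def n_def by (rule length_concat_map_uniform) simp
  show "length w = n * n + n + 1 + n * k" by (simp add: w lenA lenC)
  show "\<forall>i<n. w ! i" "\<not> w ! n" by (auto simp: w nth_append)
  show "\<forall>u<n. \<forall>v<n. w ! (Suc n + (u * n + v)) \<longleftrightarrow> {vs ! u, vs ! v} \<in> edges G"
  proof (intro allI impI)
    fix u v assume uv: "u < n" "v < n"
    have "u * n + v < Suc u * n" using uv by simp
    also have "\<dots> \<le> n * n" using uv by (intro mult_right_mono) auto
    finally have "w ! (Suc n + (u * n + v)) = A ! (u * n + v)"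
      by (simp add: w nth_append lenA)
    also have "\<dots> = ({vs ! u, vs ! v} \<in> edges G)"
      unfolding A_def using nth_concat_map_uniform[of vs "\<lambda>u. map (\<lambda>v. {u, v} \<in> edges G) vs" n u v] uv
      by (simp add: n_def)
    finally show "w ! (Suc n + (u * n + v)) \<longleftrightarrow> {vs ! u, vs ! v} \<in> edges G" .
  qed
  show "\<forall>v<n. \<forall>i<k. w ! (n * n + n + 1 + (v * k + i)) \<longleftrightarrow> Suc i \<in> L (vs ! v)"
  proof (intro allI impI)
    fix v i assume vi: "v < n" "i < k"
    have "n * n + n + 1 + (v * k + i) = n + Suc (length A + (v * k + i))" by (simp add: lenA)
    then have "w ! (n * n + n + 1 + (v * k + i)) = C ! (v * k + i)"
      by (simp only: w nth_append_length_plus nth_Cons_Suc length_replicate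
          nth_append_length_plus[of "replicate n True", simplified])
    also have "\<dots> \<longleftrightarrow> Suc i \<in> L (vs ! v)"
      unfolding C_def
      using nth_concat_map_uniform[of vs "\<lambda>v. map (\<lambda>i. i \<in> L v) [1..<Suc k]" k v i] vi
      by (simp add: n_def plus_1_eq_Suc del: upt_Suc)
    finally show "w ! (n * n + n + 1 + (v * k + i)) \<longleftrightarrow> Suc i \<in> L (vs ! v)" .
  qed
qed


section \<open>Ordered graphs by position\<close>

lemma vertex_list:
  assumes "ordered_graph G"
  shows "distinct (vertex_list G)" "set (vertex_list G) = verts G"
    "sorted_wrt (\<lambda>u v. (u, v) \<in> ord G) (vertex_list G)"
  using theI'[OF vertex_list_ex1[OF assms]] by (simp_all add: vertex_list_def)

lemma vertex_list_index:
  assumes "ordered_graph G"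
  obtains idx where "\<And>x. x \<in> verts G \<Longrightarrow> idx x < length (vertex_list G)"
    "\<And>x. x \<in> verts G \<Longrightarrow> vertex_list G ! idx x = x"
    "\<And>i. i < length (vertex_list G) \<Longrightarrow> idx (vertex_list G ! i) = i"
proof -
  let ?vs = "vertex_list G"
  have bij: "bij_betw ((!) ?vs) {..<length ?vs} (verts G)"
    using vertex_list[OF assms] by (intro bij_betw_nth) auto
  let ?idx = "inv_into {..<length ?vs} ((!) ?vs)"
  show ?thesis
  proof (rule that[of ?idx])
    show "?idx x < length ?vs" "?vs ! ?idx x = x" if "x \<in> verts G" for x
      using that bij inv_into_into[of x "(!) ?vs" "{..<length ?vs}"] f_inv_into_f[of x "(!) ?vs"]
      by (auto simp: bij_betw_def)
    show "?idx (?vs ! i) = i" if "i < length ?vs" for i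
      using that bij by (simp add: bij_betw_def inv_into_f_f)
  qed
qed

lemma edge_in_verts:
  assumes "ordered_graph G" "{u, v} \<in> edges G"
  shows "u \<in> verts G" "v \<in> verts G" "u \<noteq> v"
  using assms by (auto simp: ordered_graph_def)

lemma list_colorable_iff:
  assumes G: "ordered_graph G" and L: "\<forall>v\<in>verts G. L v \<subseteq> {1..k}"
  defines "vs \<equiv> vertex_list G"
  defines "n \<equiv> length vs"
  shows "list_colorable (G, L) \<longleftrightarrow> (\<exists>d. (\<forall>v<n. d v < k \<and> Suc (d v) \<in> L (vs ! v)) \<and>
     (\<forall>u<n. \<forall>v<n. {vs ! u, vs ! v} \<in> edges G \<longrightarrow> d u \<noteq> d v))"
proof -
  obtain idx where idx: "\<And>x. x \<in> verts G \<Longrightarrow> idx x < n" "\<And>x. x \<in> verts G \<Longrightarrow> vs ! idx x = x"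
    using vertex_list_index[OF G] unfolding n_def vs_def by metis
  have in_verts: "vs ! v \<in> verts G" if "v < n" for v
    using that vertex_list(2)[OF G] nth_mem[of v vs] by (simp add: n_def vs_def)
  show ?thesis
  proof
    assume "list_colorable (G, L)"
    then obtain c where c: "\<forall>v\<in>verts G. c v \<in> L v" "\<forall>u v. {u, v} \<in> edges G \<longrightarrow> c u \<noteq> c v"
      by (auto simp: list_colorable_def)
    \<comment> \<open>Lists contain no 0, so subtracting 1 is injective on the colours in
      use.\<close>
    have range: "Suc (c (vs ! v) - 1) = c (vs ! v) \<and> c (vs ! v) - 1 < k" if "v < n" for v
      using c(1) L in_verts[OF that] by force
    show "\<exists>d. (\<forall>v<n. d v < k \<and> Suc (d v) \<in> L (vs ! v)) \<and>
     (\<forall>u<n. \<forall>v<n. {vs ! u, vs ! v} \<in> edges G \<longrightarrow> d u \<noteq> d v)"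
    proof (intro exI[of _ "\<lambda>v. c (vs ! v) - 1"] conjI allI impI)
      show "c (vs ! v) - 1 < k" "Suc (c (vs ! v) - 1) \<in> L (vs ! v)" if "v < n" for v
        using range[OF that] c(1) in_verts[OF that] by auto
      show "c (vs ! u) - 1 \<noteq> c (vs ! v) - 1" if "u < n" "v < n" "{vs ! u, vs ! v} \<in> edges G" for u v
        using range[OF that(1)] range[OF that(2)] c(2) that(3) by metis
    qed
  next
    assume "\<exists>d. (\<forall>v<n. d v < k \<and> Suc (d v) \<in> L (vs ! v)) \<and>
     (\<forall>u<n. \<forall>v<n. {vs ! u, vs ! v} \<in> edges G \<longrightarrow> d u \<noteq> d v)"
    then obtain d where d: "\<forall>v<n. d v < k \<and> Suc (d v) \<in> L (vs ! v)"
      "\<forall>u<n. \<forall>v<n. {vs ! u, vs ! v} \<in> edges G \<longrightarrow> d u \<noteq> d v" by blast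
    have "(\<forall>v\<in>verts G. Suc (d (idx v)) \<in> L v) \<and>
        (\<forall>u v. {u, v} \<in> edges G \<longrightarrow> Suc (d (idx u)) \<noteq> Suc (d (idx v)))"
      using d idx edge_in_verts[OF G] by (metis nat.inject)
    then show "list_colorable (G, L)"
      unfolding list_colorable_def prod.case by (intro exI[of _ "\<lambda>x. Suc (d (idx x))"])
  qed
qed

lemma one_edge_graph:
  assumes H: "ordered_graph H" and "card (edges H) = 1"
  obtains a b where "a < b" "b < card (verts H)"
    "edges H = {{vertex_list H ! a, vertex_list H ! b}}"
proof -
  let ?hs = "vertex_list H"
  obtain e where e: "edges H = {e}" using assms(2) by (rule card_1_singletonE)
  then have "card e = 2" "e \<subseteq> verts H" using H by (auto simp: ordered_graph_def)
  then obtain x y where xy: "e = {x, y}" "x \<noteq> y" "x \<in> set ?hs" "y \<in> set ?hs"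
    using vertex_list(2)[OF H] by (auto simp: card_2_iff)
  then obtain i j where ij: "i < length ?hs" "j < length ?hs" "x = ?hs ! i" "y = ?hs ! j"
    by (metis in_set_conv_nth)
  have "length ?hs = card (verts H)"
    using vertex_list[OF H] distinct_card[of ?hs] by simp
  then show ?thesis
    using that[of i j] that[of j i] ij xy e by (cases i j rule: linorder_cases) (auto simp: insert_commute)
qed

text \<open>The vertex at position i of H goes to the vertex at position \<open>g i\<close> of G;
  edges and order are then compared for increasing positions, and the other pairs follow by symmetry
  or antisymmetry.\<close>

lemma induced_subgraph_if_pattern:
  fixes G :: "'a ograph" and H :: "'b ograph"
  assumes G: "ordered_graph G" and H: "ordered_graph H"
    and ab: "a < b" "b < card (verts H)" "edges H = {{vertex_list H ! a, vertex_list H ! b}}"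
    and pattern: "dp.one_edge_pattern (card (verts H)) (length (vertex_list G))
      (\<lambda>u v. {vertex_list G ! u, vertex_list G ! v} \<in> edges G) a b"
  shows "induced_subgraph H G"
proof -
  define hs where "hs = vertex_list H"
  define vs where "vs = vertex_list G"
  define t where "t = card (verts H)"
  have t: "length hs = t"
    unfolding hs_def t_def using vertex_list[OF H] distinct_card[of "vertex_list H"] by simp
  obtain idx where idx: "\<And>x. x \<in> verts H \<Longrightarrow> idx x < t" "\<And>x. x \<in> verts H \<Longrightarrow> hs ! idx x = x"
    "\<And>i. i < t \<Longrightarrow> idx (hs ! i) = i"
    using vertex_list_index[OF H] t unfolding hs_def by metis
  obtain g where g: "\<And>x. x < t \<Longrightarrow> g x < length vs" "\<And>x y. x < y \<Longrightarrow> y < t \<Longrightarrow> g x < g y"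
    "\<And>x y. x < y \<Longrightarrow> y < t \<Longrightarrow> {vs ! g x, vs ! g y} \<in> edges G \<longleftrightarrow> x = a \<and> y = b"
    using pattern unfolding dp.one_edge_pattern_def t_def vs_def by blast
  define f where "f x = vs ! g (idx x)" for x
  have linG: "linear_order_on (verts G) (ord G)" and linH: "linear_order_on (verts H) (ord H)"
    using G H by (auto simp: ordered_graph_def)
  have idx_inj: "idx x \<noteq> idx y" if "x \<in> verts H" "y \<in> verts H" "x \<noteq> y" for x y
    using that idx(2) by metis
  have f_in: "f x \<in> verts G" if "x \<in> verts H" for x
    using g(1)[OF idx(1)[OF that]] vertex_list(2)[OF G] by (auto simp: f_def vs_def)
  have f_less: "(f x, f y) \<in> ord G" "f x \<noteq> f y" if "x \<in> verts H" "y \<in> verts H" "idx x < idx y" for x y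
  proof -
    have *: "g (idx x) < g (idx y)" "g (idx y) < length vs" using that g idx by auto
    then show "(f x, f y) \<in> ord G"
      using vertex_list(3)[OF G] by (auto simp: f_def vs_def intro: sorted_wrt_nth_less)
    show "f x \<noteq> f y"
      using * vertex_list(1)[OF G] by (simp add: f_def vs_def nth_eq_iff_index_eq)
  qed
  have edge_less: "{x, y} \<in> edges H \<longleftrightarrow> {f x, f y} \<in> edges G"
    if "x \<in> verts H" "y \<in> verts H" "idx x < idx y" for x y
  proof -
    have "{x, y} \<in> edges H \<longleftrightarrow> {x, y} = {hs ! a, hs ! b}" using ab by (simp add: hs_def)
    also have "\<dots> \<longleftrightarrow> idx x = a \<and> idx y = b"
      using that idx ab by (auto simp: doubleton_eq_iff t_def)
    also have "\<dots> \<longleftrightarrow> {f x, f y} \<in> edges G" using g(3)[OF that(3)] idx that by (simp add: f_def)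
    finally show ?thesis .
  qed
  have "inj_on f (verts H)"
    using f_less(2) idx_inj by (intro inj_onI) (metis linorder_neqE_nat)
  moreover have "(f x, f y) \<in> ord G" if "x \<in> verts H" "y \<in> verts H" "(x, y) \<in> ord H" for x y
  proof (cases "x = y")
    case True
    then show ?thesis using f_in that linG by (auto simp: order_on_defs refl_on_def)
  next
    case False
    \<comment> \<open>With reversed positions both \<open>(x, y)\<close> and \<open>(y, x)\<close>
      would lie in \<open>ord H\<close>, against antisymmetry.\<close>
    have "(y, x) \<in> ord H" if "idx y < idx x"
    proof -
      have "(hs ! idx y, hs ! idx x) \<in> ord H"
        using that idx(1)[OF \<open>x \<in> verts H\<close>] vertex_list(3)[OF H] t
        by (auto simp: hs_def intro: sorted_wrt_nth_less)
      then show ?thesis using idx(2) \<open>x \<in> verts H\<close> \<open>y \<in> verts H\<close> by simp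
    qed
    then have "idx x < idx y"
      using that False idx_inj[OF that(1,2)] linH
      by (auto simp: order_on_defs antisym_def not_less_iff_gr_or_eq)
        (metis linorder_neqE_nat)
    then show ?thesis using f_less that by blast
  qed
  moreover have "{x, y} \<in> edges H \<longleftrightarrow> {f x, f y} \<in> edges G" if "x \<in> verts H" "y \<in> verts H" for x y
  proof (cases "x = y")
    case True
    then show ?thesis using edge_in_verts(3)[OF G] edge_in_verts(3)[OF H] by blast
  next
    case False
    then have "idx x < idx y \<or> idx y < idx x" using idx_inj[OF that] by auto
    then show ?thesis using edge_less[of x y] edge_less[of y x] that by (metis insert_commute)
  qed
  ultimately show ?thesis
    unfolding induced_subgraph_def using f_in by (intro exI[of _ f]) auto
qed

theorem mainTheorem1:
  fixes H :: "'a ograph" and k :: nat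
  assumes "ordered_graph H" and "card (edges H) = 1" and "k \<ge> 1"
  shows "polytime_solvable
           {(G, L) \<in> (list_coloring_instances k :: 'b list_coloring_instance set). ograph_free H G}
           (encode_instance k)
           list_colorable"
proof -
  define t where "t = card (verts H)"
  obtain a b where ab: "a < b" "b < t" "edges H = {{vertex_list H ! a, vertex_list H ! b}}"
    using one_edge_graph[OF assms(1,2)] unfolding t_def by metis
  have solves: "computes_within (coloring_prog k t) (encode_instance k (G, L))
      (poly (pcompose (cost (coloring_prog k t)) [:k, 1:]) (length (encode_instance k (G, L))))
      (list_colorable (G, L))"
    if G: "ordered_graph G" and L: "\<forall>v\<in>verts G. L v \<subseteq> {1..k}" and free: "ograph_free H G"
    for G :: "'b ograph" and L
  proof -
    define vs where "vs = vertex_list G"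
    define w where "w = encode_instance k (G, L)"
    define n where "n = length vs"
    define adj where "adj u v \<longleftrightarrow> {vs ! u, vs ! v} \<in> edges G" for u v
    define avail where "avail i v \<longleftrightarrow> Suc i \<in> L (vs ! v)" for i v
    note enc = encode_instance_nth[where G = G and L = L and k = k, folded vs_def w_def, folded n_def adj_def avail_def]
    \<comment> \<open>The rules for tests ask for k to be at most \<open>l\<close> even when the
      graph is empty and its encoding has length 1. Therefore \<open>l\<close> is the input length
      plus k, matched by composing \<open>cost\<close> with \<open>[:k, 1:]\<close>.\<close>
    interpret ram k t n adj avail "length w + k" "length w"
      by unfold_locales (simp_all add: enc(1))
    have "adj = (\<lambda>u v. {vs ! u, vs ! v} \<in> edges G)"
      by (intro ext) (simp add: adj_def)
    then have no_pattern: "\<not> one_edge_pattern a b"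
      using induced_subgraph_if_pattern[OF G assms(1) ab(1) _ ab(3)] ab(2) free
      by (auto simp: ograph_free_def t_def n_def vs_def)
    have "reach n \<noteq> {} \<longleftrightarrow> (\<exists>d. (\<forall>v<n. d v < k \<and> avail (d v) v) \<and>
        (\<forall>u<n. \<forall>v<n. adj u v \<longrightarrow> d u \<noteq> d v))"
    proof (rule reach_iff_colorable[OF _ _ ab(1,2) no_pattern])
      show "adj y x" if "adj x y" for x y using that by (simp add: adj_def insert_commute)
      show "\<not> adj x x" for x
        using edge_in_verts(3)[OF G, of "vs ! x" "vs ! x"] by (auto simp: adj_def)
    qed
    also have "\<dots> \<longleftrightarrow> list_colorable (G, L)"
      using list_colorable_iff[OF G L] by (simp add: adj_def avail_def vs_def n_def)
    finally have "wp (length w + k) (coloring_prog k t)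
        (\<lambda>s. fst s 0 = of_bool (list_colorable (G, L))) (initial_state w)"
      using wp_coloring_prog[OF refl enc(2-5)] by simp
    then show ?thesis
      unfolding wp_def computes_within_def w_def[symmetric]
      by (auto simp: poly_pcompose add.commute)
  qed
  show ?thesis
    unfolding polytime_solvable_def
    by (intro exI[of _ "coloring_prog k t"] exI[of _ "pcompose (cost (coloring_prog k t)) [:k, 1:]"])
      (auto simp: list_coloring_instances_def intro: solves)
qed

end
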